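(* Let $G$ be a graph and $\theta$ a real number, and let $Q_1,\dots,Q_m$ be the components of $G\setminus A_\theta(G)$ with $\mathrm{mult}(\theta,Q_j)=0$. For distinct vertices $u,v$, the pair $\{u,v\}$ is an edge of $D_\theta(G)$ (i.e. $\mathrm{mult}(\theta,G\setminus\{u,v\})\le\mathrm{mult}(\theta,G)$) if and only if one of the following holds: (a) $u\in B_\theta(G)$ or $v\in B_\theta(G)$; (b) $u,v\in N_\theta(G)$ with $u\in V(Q_{j_1})$, $v\in V(Q_{j_2})$ for some $j_1\neq j_2$; (c) $u,v\in V(Q_{j_0})$ for some $j_0$ and $\mathrm{mult}(\theta,Q_{j_0}\setminus\{u,v\})=0$.
   Context: All graphs are finite and simple. For a graph $G$ on $n$ vertices, let $p(G,r)$ be the number of $r$-matchings of $G$ ($p(G,0)=1$); the matching polynomial is $\mu(G,x)=\sum_{r=0}^{\lfloor n/2\rfloor}(-1)^r p(G,r)x^{n-2r}$. For real $\theta$, $\mathrm{mult}(\theta,G)$ is the multiplicity of $\theta$ as a root of $\mu(G,x)$ (it is $0$ if $\theta$ is not a root). $G\setminus X$ denotes deletion of the vertex set $X$; $G\setminus u=G\setminus\{u\}$. A vertex $u$ is $\theta$-essential, $\theta$-neutral, or $\theta$-positive in $G$ according as $\mathrm{mult}(\theta,G\setminus u)$ equals $\mathrm{mult}(\theta,G)-1$, $\mathrm{mult}(\theta,G)$, or $\mathrm{mult}(\theta,G)+1$. A vertex is $\theta$-special if it is not $\theta$-essential but is adjacent to a $\theta$-essential vertex. $B_\theta(G)$,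 $A_\theta(G)$, $N_\theta(G)$ are the sets of $\theta$-essential, $\theta$-special, $\theta$-neutral vertices. A connected graph is $\theta$-critical if all its vertices are $\theta$-essential in it; every component of $G\setminus A_\theta(G)$ is either $\theta$-critical or has $\mathrm{mult}(\theta,\cdot)=0$. The graph $D_\theta(G)$ has vertex set $V(G)$, and distinct $x,y$ are adjacent in $D_\theta(G)$ iff $\mathrm{mult}(\theta,G\setminus\{x,y\})\le\mathrm{mult}(\theta,G)$. *)

theory Defs
  imports "HOL-Computational_Algebra.Polynomial"
begin

text \<open>A finite simple graph is given by a finite vertex set V and a symmetric,
irreflexive adjacency relation E; only edges between vertices of V count.
Deleting a vertex set X is the induced subgraph on V - X with the same E.\<close>

definition simple_graph :: "'a set \<Rightarrow> ('a \<Rightarrow> 'a \<Rightarrow> bool) \<Rightarrow> bool" where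
  "simple_graph V E \<longleftrightarrow> finite V \<and> (\<forall>x y. E x y \<longrightarrow> E y x) \<and> (\<forall>x. \<not> E x x)"

definition graph_edges :: "'a set \<Rightarrow> ('a \<Rightarrow> 'a \<Rightarrow> bool) \<Rightarrow> 'a set set" where
  "graph_edges V E = {{x, y} | x y. x \<in> V \<and> y \<in> V \<and> E x y}"

definition is_matching :: "'a set \<Rightarrow> ('a \<Rightarrow> 'a \<Rightarrow> bool) \<Rightarrow> 'a set set \<Rightarrow> bool" where
  "is_matching V E M \<longleftrightarrow> M \<subseteq> graph_edges V E \<and>
     (\<forall>e1\<in>M. \<forall>e2\<in>M. e1 \<noteq> e2 \<longrightarrow> e1 \<inter> e2 = {})"

definition num_matchings :: "'a set \<Rightarrow> ('a \<Rightarrow> 'a \<Rightarrow> bool) \<Rightarrow> nat \<Rightarrow> nat" where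
  "num_matchings V E r = card {M. is_matching V E M \<and> card M = r}"

definition matching_poly :: "'a set \<Rightarrow> ('a \<Rightarrow> 'a \<Rightarrow> bool) \<Rightarrow> real poly" where
  "matching_poly V E = (\<Sum>r\<le>card V div 2.
      monom ((-1) ^ r * real (num_matchings V E r)) (card V - 2 * r))"

definition mult :: "real \<Rightarrow> 'a set \<Rightarrow> ('a \<Rightarrow> 'a \<Rightarrow> bool) \<Rightarrow> nat" where
  "mult \<theta> V E = order \<theta> (matching_poly V E)"

definition essential :: "real \<Rightarrow> 'a set \<Rightarrow> ('a \<Rightarrow> 'a \<Rightarrow> bool) \<Rightarrow> 'a \<Rightarrow> bool" where
  "essential \<theta> V E u \<longleftrightarrow> u \<in> V \<and> mult \<theta> (V - {u}) E + 1 = mult \<theta> V E"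

definition neutral :: "real \<Rightarrow> 'a set \<Rightarrow> ('a \<Rightarrow> 'a \<Rightarrow> bool) \<Rightarrow> 'a \<Rightarrow> bool" where
  "neutral \<theta> V E u \<longleftrightarrow> u \<in> V \<and> mult \<theta> (V - {u}) E = mult \<theta> V E"

definition positive :: "real \<Rightarrow> 'a set \<Rightarrow> ('a \<Rightarrow> 'a \<Rightarrow> bool) \<Rightarrow> 'a \<Rightarrow> bool" where
  "positive \<theta> V E u \<longleftrightarrow> u \<in> V \<and> mult \<theta> (V - {u}) E = mult \<theta> V E + 1"

definition special :: "real \<Rightarrow> 'a set \<Rightarrow> ('a \<Rightarrow> 'a \<Rightarrow> bool) \<Rightarrow> 'a \<Rightarrow> bool" where
  "special \<theta> V E u \<longleftrightarrow> u \<in> V \<and> \<not> essential \<theta> V E u \<and>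
     (\<exists>w. essential \<theta> V E w \<and> E u w)"

definition B_set :: "real \<Rightarrow> 'a set \<Rightarrow> ('a \<Rightarrow> 'a \<Rightarrow> bool) \<Rightarrow> 'a set" where
  "B_set \<theta> V E = {u. essential \<theta> V E u}"

definition A_set :: "real \<Rightarrow> 'a set \<Rightarrow> ('a \<Rightarrow> 'a \<Rightarrow> bool) \<Rightarrow> 'a set" where
  "A_set \<theta> V E = {u. special \<theta> V E u}"

definition N_set :: "real \<Rightarrow> 'a set \<Rightarrow> ('a \<Rightarrow> 'a \<Rightarrow> bool) \<Rightarrow> 'a set" where
  "N_set \<theta> V E = {u. neutral \<theta> V E u}"

definition components :: "'a set \<Rightarrow> ('a \<Rightarrow> 'a \<Rightarrow> bool) \<Rightarrow> 'a set set" where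
  "components V E = {{y. (\<lambda>a b. a \<in> V \<and> b \<in> V \<and> E a b)\<^sup>*\<^sup>* x y} | x. x \<in> V}"

end

theory Submission
  imports Defs
begin

text \<open>
The identity
\<open>\<mu>(G-u) \<mu>(G-v) - \<mu>(G) \<mu>(G-uv) = \<Sum>\<^sub>P \<mu>(G-P)\<^sup>2\<close>, the sum ranging over the paths from \<open>u\<close> to \<open>v\<close>,
makes the left-hand side nonnegative on the real line, so its order at \<open>\<theta>\<close> is even.
Comparing parities of multiplicities shows that special vertices are positive. Applied to a
matching polynomial with a generic shift at one vertex, it also shows that among the essential vertices
the relation \<open>mult(G-uv) \<ge> mult(G) - 1\<close> is transitive. A vertex \<open>a\<close> is positive in \<open>G\<close> iff
some neighbour of \<open>a\<close> is essential in \<open>G-a\<close>. If \<open>a\<close> is special, adjacent to the essential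
vertex \<open>w\<close>, and some nonessential \<open>u\<close> became essential in \<open>G-a\<close>, then \<open>a\<close> would not be positive
in \<open>G-u\<close>, so \<open>u\<close> would be related in \<open>G-a\<close> to all neighbours of \<open>a\<close>; but \<open>a\<close> is positive in \<open>G-w\<close>, which
yields a neighbour not related to \<open>w\<close>. Hence deleting special vertices preserves
the types of all other vertices and also the edges of \<open>D\<^sub>\<theta>\<close> between nonessential vertices. Once no special
vertices are left, each component consists of essential vertices or has multiplicity zero, and
multiplicities add over components.
\<close>

section \<open>Local behaviour of real polynomials\<close>

lemma coeff_less_order_0:
  fixes p :: "real poly"
  assumes "i < order 0 p"
  shows "coeff p i = 0"
proof (cases "p = 0")
  case False
  then have "monom 1 (order 0 p) dvd p" by (simp add: monom_1_dvd_iff)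
  then show ?thesis using assms by (simp add: monom_1_dvd_iff')
qed simp

lemma le_order_0_iff:
  fixes p :: "real poly"
  assumes "p \<noteq> 0"
  shows "n \<le> order 0 p \<longleftrightarrow> (\<forall>i<n. coeff p i = 0)"
  using assms by (simp add: monom_1_dvd_iff monom_1_dvd_iff' flip: monom_1_dvd_iff)

lemma coeff_order_0_nonzero:
  fixes p :: "real poly"
  assumes "p \<noteq> 0"
  shows "coeff p (order 0 p) \<noteq> 0"
proof
  assume "coeff p (order 0 p) = 0"
  then have "Suc (order 0 p) \<le> order 0 p"
    using assms by (subst le_order_0_iff) (auto simp: less_Suc_eq coeff_less_order_0)
  then show False by simp
qed

text \<open>Splitting off the powers of the variable leaves cofactors whose values at 0 multiply.
  Here \<open>m\<close> and \<open>n\<close> only bound the orders from below, so the lemma also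
  serves where exact orders are unknown.\<close>

lemma coeff_mult_low:
  fixes p q :: "real poly"
  assumes "\<forall>i<m. coeff p i = 0" "\<forall>i<n. coeff q i = 0"
  shows "\<forall>i<m+n. coeff (p * q) i = 0" "coeff (p * q) (m + n) = coeff p m * coeff q n"
proof -
  obtain p' where p: "p = monom 1 m * p'" using assms(1) by (auto simp: dvd_def simp flip: monom_1_dvd_iff')
  obtain q' where q: "q = monom 1 n * q'" using assms(2) by (auto simp: dvd_def simp flip: monom_1_dvd_iff')
  have "p * q = monom 1 m * monom 1 n * (p' * q')" unfolding p q by (simp only: ac_simps)
  then have pq: "p * q = monom 1 (m + n) * (p' * q')" by (simp add: mult_monom)
  show "\<forall>i<m+n. coeff (p * q) i = 0" "coeff (p * q) (m + n) = coeff p m * coeff q n"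
    unfolding pq by (auto simp: p q coeff_monom_mult coeff_mult_0)
qed

text \<open>Write \<open>p\<close> as \<open>x ^ n\<close> times a cofactor \<open>r\<close>. Near 0
  the sign of \<open>p\<close> is that of \<open>x ^ n\<close> times \<open>poly r 0\<close>, and
  for odd \<open>n\<close> the power takes both signs, so \<open>poly r 0\<close> must
  vanish.\<close>

lemma nonneg_poly_low_coeff:
  fixes p :: "real poly"
  assumes nn: "\<And>x. 0 \<le> poly p x" and low: "\<forall>i<n. coeff p i = 0"
  shows "0 \<le> coeff p n" "odd n \<Longrightarrow> coeff p n = 0"
proof -
  obtain r where p: "p = monom 1 n * r" using low by (auto simp: dvd_def simp flip: monom_1_dvd_iff')
  have c: "coeff p n = poly r 0" unfolding p by (simp add: coeff_monom_mult poly_0_coeff_0)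
  have px: "poly p x = x ^ n * poly r x" for x unfolding p by (simp add: poly_monom)
  have cont: "isCont (poly r) 0" by simp
  show 1: "0 \<le> coeff p n"
  proof (rule ccontr)
    assume "\<not> 0 \<le> coeff p n"
    then have "\<forall>\<^sub>F x in at 0. poly r x < 0"
      using cont c by (auto simp: isCont_def intro: order_tendstoD)
    then obtain d where d: "d > 0" "\<And>x. x \<noteq> 0 \<Longrightarrow> dist x 0 < d \<Longrightarrow> poly r x < 0"
      by (auto simp: eventually_at)
    have "poly r (d/2) < 0" using d(1) by (intro d(2)) (auto simp: dist_real_def)
    then have "poly p (d/2) < 0" unfolding px using d(1) by (simp add: mult_pos_neg)
    then show False using nn[of "d/2"] by simp
  qed
  show "coeff p n = 0" if odd: "odd n"
  proof (rule ccontr)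
    assume "coeff p n \<noteq> 0"
    then have "0 < poly r 0" using 1 c by simp
    then have "\<forall>\<^sub>F x in at 0. 0 < poly r x"
      using cont by (auto simp: isCont_def intro: order_tendstoD)
    then obtain d where d: "d > 0" "\<And>x. x \<noteq> 0 \<Longrightarrow> dist x 0 < d \<Longrightarrow> 0 < poly r x"
      by (auto simp: eventually_at)
    have "0 < poly r (-(d/2))" using d(1) by (intro d(2)) (auto simp: dist_real_def)
    moreover have "(-(d/2)) ^ n < 0" using odd d(1) by (simp add: power_less_zero_eq)
    ultimately have "poly p (-(d/2)) < 0" unfolding px by (simp add: mult_neg_pos)
    then show False using nn[of "-(d/2)"] by simp
  qed
qed

text \<open>If the two products have different orders, the lowest term of their difference is, up to
  sign, that of the product of smaller order. Nonnegativity forces this order to be even.\<close>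

lemma nonneg_diff_even_order:
  fixes a b c d :: "real poly"
  assumes nn: "\<And>x. poly (c * d) x \<le> poly (a * b) x"
    and nz: "a \<noteq> 0" "b \<noteq> 0" "c \<noteq> 0" "d \<noteq> 0"
  shows "order 0 a + order 0 b < order 0 c + order 0 d \<Longrightarrow> even (order 0 a + order 0 b)"
    "order 0 c + order 0 d < order 0 a + order 0 b \<Longrightarrow> even (order 0 c + order 0 d)"
proof -
  have pos: "0 \<le> poly (a * b - c * d) x" for x using nn[of x] by simp
  have ab: "\<forall>i<order 0 a + order 0 b. coeff (a * b) i = 0"
      "coeff (a * b) (order 0 a + order 0 b) \<noteq> 0"
    using coeff_mult_low[of "order 0 a" a "order 0 b" b] coeff_less_order_0 coeff_order_0_nonzero nz
    by auto
  have cd: "\<forall>i<order 0 c + order 0 d. coeff (c * d) i = 0"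
      "coeff (c * d) (order 0 c + order 0 d) \<noteq> 0"
    using coeff_mult_low[of "order 0 c" c "order 0 d" d] coeff_less_order_0 coeff_order_0_nonzero nz
    by auto
  show "even (order 0 a + order 0 b)" if "order 0 a + order 0 b < order 0 c + order 0 d"
    using nonneg_poly_low_coeff(2)[of "a * b - c * d" "order 0 a + order 0 b"] pos ab cd that by auto
  show "even (order 0 c + order 0 d)" if "order 0 c + order 0 d < order 0 a + order 0 b"
    using nonneg_poly_low_coeff(2)[of "a * b - c * d" "order 0 c + order 0 d"] pos ab cd that by auto
qed

text \<open>Otherwise the lowest term of \<open>p - q * q\<close> would be minus the square of the
  lowest term of \<open>q\<close>, making the difference negative near 0.\<close>

lemma square_le_order:
  fixes p q :: "real poly"
  assumes nn: "\<And>x. (poly q x)\<^sup>2 \<le> poly p x" and "q \<noteq> 0" and low: "\<forall>i<n. coeff p i = 0"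
  shows "n \<le> 2 * order 0 q"
proof (rule ccontr)
  assume *: "\<not> n \<le> 2 * order 0 q"
  define m where "m = order 0 q"
  have q: "\<forall>i<m+m. coeff (q * q) i = 0" "coeff (q * q) (m + m) = coeff q m * coeff q m"
    using coeff_mult_low[of m q m q] coeff_less_order_0 unfolding m_def by auto
  have "0 \<le> coeff (p - q * q) (m + m)"
    using nn low q * by (intro nonneg_poly_low_coeff(1)) (auto simp: m_def power2_eq_square)
  moreover have "coeff p (m + m) = 0" using low * by (auto simp: m_def)
  moreover have "coeff q m \<noteq> 0" using assms(2) coeff_order_0_nonzero m_def by auto
  ultimately show False using q(2) by (auto simp: mult_le_0_iff)
qed

text \<open>The inequality says that \<open>q/p\<close> decreases strictly, so its poles are simple with positive residue.\<close>
lemma wronskian_order: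
  fixes p q :: "real poly"
  assumes nn: "\<And>x. (poly q x)\<^sup>2 \<le> poly (pderiv p * q - p * pderiv q) x"
    and nz: "p \<noteq> 0" "q \<noteq> 0"
  shows "order 0 p \<le> Suc (order 0 q)"
    "order 0 p = Suc (order 0 q) \<Longrightarrow> 0 < coeff p (order 0 p) * coeff q (order 0 q)"
proof -
  define a b where "a = order 0 p" and "b = order 0 q"
  define W where "W = pderiv p * q - p * pderiv q"
  have p: "\<forall>i<a. coeff p i = 0" and q: "\<forall>i<b. coeff q i = 0" and qb: "coeff q b \<noteq> 0"
    using coeff_less_order_0 coeff_order_0_nonzero nz unfolding a_def b_def by auto
  have dp: "\<forall>i<a-1. coeff (pderiv p) i = 0" and dq: "\<forall>i<b-1. coeff (pderiv q) i = 0"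
    using p q by (auto simp: coeff_pderiv)
  have A: "\<forall>i<(a-1)+b. coeff (pderiv p * q) i = 0"
    "coeff (pderiv p * q) ((a-1)+b) = coeff (pderiv p) (a-1) * coeff q b"
    using coeff_mult_low[OF dp q] by auto
  have B: "\<forall>i<a+(b-1). coeff (p * pderiv q) i = 0"
    "coeff (p * pderiv q) (a+(b-1)) = coeff p a * coeff (pderiv q) (b-1)"
    using coeff_mult_low[OF p dq] by auto
  \<comment> \<open>Truncated subtraction is harmless: differentiation lowers a positive order by
    one, and an order 0 simply stays 0 as a lower bound.\<close>
  have low: "\<forall>i<a+b-1. coeff W i = 0"
    using A(1) B(1) unfolding W_def by auto
  show "a \<le> Suc b"
  proof (rule ccontr)
    assume "\<not> a \<le> Suc b"
    moreover have "a + b - 1 \<le> 2 * b"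
      using square_le_order[of q W "a+b-1"] nn nz(2) low unfolding W_def b_def by blast
    ultimately show False by simp
  qed
  show "0 < coeff p a * coeff q b" if eq: "a = Suc b"
  proof -
    have q2: "\<forall>i<b+b. coeff (q * q) i = 0" "coeff (q * q) (b + b) = coeff q b * coeff q b"
      using coeff_mult_low[OF q q] by auto
    have "coeff (p * pderiv q) (b + b) = real b * (coeff p a * coeff q b)"
      using B eq by (cases b) (auto simp: coeff_pderiv)
    moreover have "coeff (pderiv p * q) (b + b) = real a * (coeff p a * coeff q b)"
      using A eq by (auto simp: coeff_pderiv)
    \<comment> \<open>The two products contribute with factors \<open>a\<close> and
      \<open>b\<close>, and \<open>a - b = 1\<close>. Comparison with the strictly positive lowest
      coefficient of \<open>q * q\<close> then gives the sign.\<close>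
    ultimately have W: "coeff W (b + b) = coeff p a * coeff q b"
      unfolding W_def eq by (simp add: algebra_simps)
    have "0 \<le> coeff (W - q * q) (b + b)"
      using nn low q2 eq by (intro nonneg_poly_low_coeff(1)) (auto simp: W_def power2_eq_square)
    then have "coeff q b * coeff q b \<le> coeff p a * coeff q b" using W q2(2) by simp
    moreover have "0 < coeff q b * coeff q b" using qb by (auto simp: zero_less_mult_iff)
    ultimately show ?thesis by simp
  qed
qed

text \<open>The translation turns the power of \<open>[:-t, 1:]\<close> into a power of the variable
  and leaves a cofactor that does not vanish at 0.\<close>

lemma order_pcompose_shift:
  fixes p :: "real poly"
  assumes "p \<noteq> 0"
  shows "order 0 (pcompose p [:t, 1:]) = order t p"
proof -
  obtain q where q: "p = [:-t, 1:] ^ order t p * q" "\<not> [:-t, 1:] dvd q"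
    using order_decomp[OF assms] by blast
  have qt: "poly q t \<noteq> 0" using q(2) by (simp add: poly_eq_0_iff_dvd)
  have pow: "pcompose ([:-t, 1:] ^ n) [:t, 1:] = monom 1 n" for n
  proof (induction n)
    case (Suc n)
    have "pcompose [:-t, 1:] [:t, 1:] = [:0, 1:]" by (simp add: pcompose_pCons)
    then show ?case
      unfolding power_Suc pcompose_mult Suc by (simp add: monom_Suc)
  qed (simp add: pcompose_1)
  have "pcompose p [:t, 1:] = monom 1 (order t p) * pcompose q [:t, 1:]"
    by (subst q(1)) (simp only: pcompose_mult pow)
  moreover have "poly (pcompose q [:t, 1:]) 0 \<noteq> 0" using qt by (simp add: poly_pcompose)
  moreover from this have "pcompose q [:t, 1:] \<noteq> 0" by auto
  ultimately show ?thesis by (simp add: order_mult order_0I)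
qed

section \<open>Weighted matching polynomials\<close>

locale matching_graph =
  fixes E :: "'a \<Rightarrow> 'a \<Rightarrow> bool"
  assumes sym: "E x y \<Longrightarrow> E y x" and irrefl: "\<not> E x x"
begin

text \<open>With \<open>c\<close> constantly \<open>\<theta>\<close> this is \<open>\<mu>(S, x + \<theta>)\<close>, so that multiplicities become orders at 0.\<close>
definition mpoly :: "('a \<Rightarrow> real) \<Rightarrow> 'a set \<Rightarrow> real poly" where
  "mpoly c S = (\<Sum>M | is_matching S E M. (-1) ^ card M * (\<Prod>v\<in>S - \<Union>M. [:c v, 1:]))"

section \<open>Matchings under vertex deletion\<close>

lemma graph_edges_mono: "S \<subseteq> T \<Longrightarrow> graph_edges S E \<subseteq> graph_edges T E"
  unfolding graph_edges_def by blast

lemma is_matching_Union: "is_matching S E M \<Longrightarrow> \<Union>M \<subseteq> S"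
  by (auto simp: is_matching_def graph_edges_def)

lemma is_matching_subset: "is_matching S E M \<Longrightarrow> M \<subseteq> Pow S"
  using is_matching_Union by blast

lemma finite_matchings: "finite S \<Longrightarrow> finite {M. is_matching S E M}"
  by (rule finite_subset[of _ "Pow (Pow S)"]) (auto dest: is_matching_Union)

lemma finite_matching: "finite S \<Longrightarrow> is_matching S E M \<Longrightarrow> finite M"
  using finite_subset[of M "Pow S"] is_matching_subset by auto

lemma is_matching_avoid:
  "is_matching (S - {u}) E M \<longleftrightarrow> is_matching S E M \<and> u \<notin> \<Union>M"
proof
  assume "is_matching (S - {u}) E M"
  then show "is_matching S E M \<and> u \<notin> \<Union>M"
    using is_matching_Union[of "S - {u}" M] graph_edges_mono[of "S - {u}" S]
    unfolding is_matching_def by blast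
next
  assume M: "is_matching S E M \<and> u \<notin> \<Union>M"
  have "M \<subseteq> graph_edges (S - {u}) E"
  proof
    fix e assume "e \<in> M"
    then obtain x y where "e = {x, y}" "x \<in> S" "y \<in> S" "E x y"
      using M unfolding is_matching_def graph_edges_def by blast
    moreover have "u \<notin> e" using M \<open>e \<in> M\<close> by blast
    ultimately show "e \<in> graph_edges (S - {u}) E" unfolding graph_edges_def by blast
  qed
  then show "is_matching (S - {u}) E M" using M unfolding is_matching_def by blast
qed

lemma is_matching_insert:
  assumes "u \<in> S" "y \<in> S" "E u y" "is_matching (S - {u, y}) E M"
  shows "is_matching S E (insert {u, y} M)"
proof -
  have "\<Union>M \<subseteq> S - {u, y}" using assms(4) by (rule is_matching_Union)
  then have "\<forall>e\<in>M. u \<notin> e \<and> y \<notin> e" by blast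
  moreover have "M \<subseteq> graph_edges S E" "\<forall>e1\<in>M. \<forall>e2\<in>M. e1 \<noteq> e2 \<longrightarrow> e1 \<inter> e2 = {}"
    using assms(4) graph_edges_mono[of "S - {u, y}" S] unfolding is_matching_def by blast+
  moreover have "{u, y} \<in> graph_edges S E" using assms(1-3) unfolding graph_edges_def by blast
  ultimately show ?thesis unfolding is_matching_def by blast
qed

text \<open>Remove the edge of \<open>M\<close> through \<open>u\<close>: by disjointness all other
  edges avoid both of its ends.\<close>

lemma is_matching_split:
  assumes "is_matching S E M" "u \<in> \<Union>M"
  shows "\<exists>y\<in>S. E u y \<and> M \<in> insert {u, y} ` {M'. is_matching (S - {u, y}) E M'}"
proof -
  obtain e where e: "e \<in> M" "u \<in> e" using assms(2) by blast
  then obtain y where y: "y \<in> S" "E u y" "e = {u, y}"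
  proof -
    obtain x z where "e = {x, z}" "x \<in> S" "z \<in> S" "E x z"
      using e(1) assms(1) unfolding is_matching_def graph_edges_def by blast
    then show ?thesis using e(2) sym that by (cases "u = x") (auto simp: insert_commute)
  qed
  have "is_matching (S - {u, y}) E (M - {e})"
  proof -
    have "u \<notin> f \<and> y \<notin> f" if "f \<in> M - {e}" for f
    proof -
      have "f \<inter> e = {}" using that e(1) assms(1) unfolding is_matching_def by blast
      then show ?thesis using y(3) by auto
    qed
    then have "u \<notin> \<Union>(M - {e})" "y \<notin> \<Union>(M - {e})" by blast+
    moreover have "is_matching S E (M - {e})" using assms(1) by (auto simp: is_matching_def)
    ultimately have "is_matching (S - {u} - {y}) E (M - {e})" by (simp add: is_matching_avoid)
    then show ?thesis by (simp add: Diff_insert2[symmetric])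
  qed
  moreover have "M = insert {u, y} (M - {e})" using e y by auto
  ultimately show ?thesis using y by blast
qed

section \<open>Recursion, degree, products and derivative\<close>

text \<open>A matching either misses \<open>u\<close>, which then contributes its linear factor, or
  contains exactly one edge \<open>{u, y}\<close>. Removing that edge leaves a matching of
  \<open>S - {u, y}\<close> and costs one sign.\<close>

lemma mpoly_rec:
  assumes S: "finite S" and u: "u \<in> S"
  shows "mpoly c S = [:c u, 1:] * mpoly c (S - {u}) - (\<Sum>y\<in>{y\<in>S. E u y}. mpoly c (S - {u, y}))"
proof -
  define T where "T M = (-1) ^ card M * (\<Prod>v\<in>S - \<Union>M. [:c v, 1:])" for M
  define N where "N = {y\<in>S. E u y}"
  define I where "I y = insert {u, y} ` {M. is_matching (S - {u, y}) E M}" for y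
  have fin: "finite (I y)" for y unfolding I_def using S by (auto intro: finite_matchings)
  have sep: "u \<notin> \<Union>M" "y \<notin> \<Union>M" if "is_matching (S - {u, y}) E M" for y M
    using is_matching_Union[OF that] by auto
  have disj: "I y \<inter> I z = {}" if "y \<noteq> z" for y z
  proof (rule ccontr)
    assume "I y \<inter> I z \<noteq> {}"
    then obtain M M' where M: "is_matching (S - {u, y}) E M" "is_matching (S - {u, z}) E M'"
      and eq: "insert {u, y} M = insert {u, z} M'"
      unfolding I_def by auto
    have "{u, z} \<noteq> {u, y}" using that by (auto simp: doubleton_eq_iff)
    moreover have "{u, z} \<in> insert {u, y} M" unfolding eq by simp
    ultimately have "{u, z} \<in> M" by simp
    then show False using sep(1)[OF M(1)] by auto
  qed
  have "{M. is_matching S E M} = {M. is_matching (S - {u}) E M} \<union> (\<Union>y\<in>N. I y)"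
  proof (intro equalityI subsetI)
    fix M assume "M \<in> {M. is_matching S E M}"
    then show "M \<in> {M. is_matching (S - {u}) E M} \<union> (\<Union>y\<in>N. I y)"
      using is_matching_split[of S M u] by (cases "u \<in> \<Union>M") (auto simp: is_matching_avoid N_def I_def)
  next
    fix M assume "M \<in> {M. is_matching (S - {u}) E M} \<union> (\<Union>y\<in>N. I y)"
    then show "M \<in> {M. is_matching S E M}"
      using is_matching_insert[OF u] by (auto simp: is_matching_avoid N_def I_def)
  qed
  moreover have "{M. is_matching (S - {u}) E M} \<inter> (\<Union>y\<in>N. I y) = {}"
    unfolding I_def by (auto simp: is_matching_avoid)
  ultimately have "mpoly c S = sum T {M. is_matching (S - {u}) E M} + sum T (\<Union>y\<in>N. I y)"
    unfolding mpoly_def T_def[symmetric] using S fin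
    by (simp add: sum.union_disjoint finite_matchings N_def)
  also have "sum T (\<Union>y\<in>N. I y) = (\<Sum>y\<in>N. sum T (I y))"
    using S fin disj by (intro sum.UNION_disjoint) (auto simp: N_def)
  also have "(\<Sum>y\<in>N. sum T (I y)) = (\<Sum>y\<in>N. - mpoly c (S - {u, y}))"
  proof (rule sum.cong)
    fix y assume "y \<in> N"
    have inj: "inj_on (insert {u, y}) {M. is_matching (S - {u, y}) E M}"
    proof (rule inj_onI)
      fix M M' assume "M \<in> {M. is_matching (S - {u, y}) E M}" "M' \<in> {M. is_matching (S - {u, y}) E M}"
        and eq: "insert {u, y} M = insert {u, y} M'"
      then have "{u, y} \<notin> M" "{u, y} \<notin> M'" using sep(1) by blast+
      then show "M = M'" using eq by (simp add: insert_ident)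
    qed
    have "sum T (I y) = (\<Sum>M | is_matching (S - {u, y}) E M. T (insert {u, y} M))"
      unfolding I_def using sum.reindex[OF inj] by simp
    also have "\<dots> = (\<Sum>M | is_matching (S - {u, y}) E M.
        - ((-1) ^ card M * (\<Prod>v\<in>S - {u, y} - \<Union>M. [:c v, 1:])))"
    proof (rule sum.cong)
      fix M assume "M \<in> {M. is_matching (S - {u, y}) E M}"
      then have M: "is_matching (S - {u, y}) E M" by simp
      have "{u, y} \<notin> M" using sep(1)[OF M] by blast
      moreover have "finite M" using finite_matching[OF _ M] S by simp
      moreover have "S - \<Union>(insert {u, y} M) = S - {u, y} - \<Union>M" by auto
      ultimately show "T (insert {u, y} M) = - ((-1) ^ card M * (\<Prod>v\<in>S - {u, y} - \<Union>M. [:c v, 1:]))"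
        unfolding T_def by simp
    qed simp
    also have "\<dots> = - mpoly c (S - {u, y})" unfolding mpoly_def by (simp add: sum_negf)
    finally show "sum T (I y) = - mpoly c (S - {u, y})" .
  qed simp
  also have "sum T {M. is_matching (S - {u}) E M} = [:c u, 1:] * mpoly c (S - {u})"
    unfolding mpoly_def sum_distrib_left
  proof (rule sum.cong)
    fix M assume "M \<in> {M. is_matching (S - {u}) E M}"
    then have "S - \<Union>M = insert u (S - {u} - \<Union>M)" using u by (auto simp: is_matching_avoid)
    moreover have "u \<notin> S - {u} - \<Union>M" by simp
    ultimately have "(\<Prod>v\<in>S - \<Union>M. [:c v, 1:]) = [:c u, 1:] * (\<Prod>v\<in>S - {u} - \<Union>M. [:c v, 1:])"
      using S prod.insert[of "S - {u} - \<Union>M" u "\<lambda>v. [:c v, 1:]"] by simp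
    then show "T M = [:c u, 1:] * ((-1) ^ card M * (\<Prod>v\<in>S - {u} - \<Union>M. [:c v, 1:]))"
      unfolding T_def by (simp only: ac_simps)
  qed simp
  finally show ?thesis unfolding N_def by (simp add: sum_negf)
qed

lemma mpoly_empty [simp]: "mpoly c {} = 1"
proof -
  have "{M. is_matching {} E M} = {{}}" by (auto simp: is_matching_def graph_edges_def)
  then show ?thesis by (simp add: mpoly_def)
qed

lemma mpoly_cong: "(\<And>v. v \<in> S \<Longrightarrow> c v = d v) \<Longrightarrow> mpoly c S = mpoly d S"
  unfolding mpoly_def by (intro sum.cong refl arg_cong2[of _ _ _ _ "(*)"] prod.cong) auto

text \<open>In the recursion only the linear factor times the one-vertex deletion reaches the top
  degree. The purpose is that the polynomial is never zero, so orders are meaningful and add up in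
  products.\<close>

lemma mpoly_monic:
  assumes "finite S"
  shows "degree (mpoly c S) = card S \<and> coeff (mpoly c S) (card S) = 1"
  using assms
proof (induction "card S" arbitrary: S rule: less_induct)
  case less
  show ?case
  proof (cases "S = {}")
    case False
    then obtain u where u: "u \<in> S" by blast
    then obtain n where n: "card S = Suc n" using less.prems by (metis card_Suc_Diff1)
    have cu: "card (S - {u}) = n" using u n less.prems by simp
    have deg: "degree (\<Sum>y\<in>{y\<in>S. E u y}. mpoly c (S - {u, y})) \<le> n"
    proof (rule degree_sum_le)
      fix y assume "y \<in> {y \<in> S. E u y}"
      have "card (S - {u, y}) \<le> card (S - {u})" using less.prems by (intro card_mono) auto
      then show "degree (mpoly c (S - {u, y})) \<le> n"
        using less.hyps[of "S - {u, y}"] less.prems n cu by simp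
    qed (use less.prems in simp)
    have IH: "degree (mpoly c (S - {u})) = n" "coeff (mpoly c (S - {u})) n = 1"
      using less.hyps[of "S - {u}"] less.prems n cu by auto
    have top: "coeff (mpoly c S) (Suc n) = 1"
      unfolding mpoly_rec[OF less.prems u] using deg IH
      by (simp add: coeff_eq_0)
    have "degree (mpoly c S) \<le> Suc n"
      unfolding mpoly_rec[OF less.prems u]
    proof (rule degree_diff_le)
      show "degree ([:c u, 1:] * mpoly c (S - {u})) \<le> Suc n"
        using degree_mult_le[of "[:c u, 1:]" "mpoly c (S - {u})"] IH(1) by simp
    qed (use deg in simp)
    then show ?thesis using top n le_degree[of "mpoly c S" "Suc n"] by auto
  qed simp
qed

lemma mpoly_nonzero [simp]: "finite S \<Longrightarrow> mpoly c S \<noteq> 0"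
  using mpoly_monic[of S c] by auto

text \<open>Expand at a vertex of \<open>S\<close>: its neighbours in the union all lie in
  \<open>S\<close>, so the factor of \<open>T\<close> comes out of every term.\<close>

lemma mpoly_disjoint_union:
  assumes "finite S" "finite T" "S \<inter> T = {}" "\<And>x y. x \<in> S \<Longrightarrow> y \<in> T \<Longrightarrow> \<not> E x y"
  shows "mpoly c (S \<union> T) = mpoly c S * mpoly c T"
  using assms
proof (induction "card S" arbitrary: S rule: less_induct)
  case less
  show ?case
  proof (cases "S = {}")
    case False
    then obtain u where u: "u \<in> S" by blast
    have IH: "mpoly c ((S - X) \<union> T) = mpoly c (S - X) * mpoly c T" if "u \<in> X" for X
    proof (rule less.hyps)
      show "card (S - X) < card S" using u that less.prems(1) by (intro psubset_card_mono) auto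
    qed (use less.prems in auto)
    have D: "S \<union> T - X = (S - X) \<union> T" if "X \<subseteq> S" for X using that less.prems(3) by auto
    have N: "{y \<in> S \<union> T. E u y} = {y \<in> S. E u y}" using u less.prems(4) by auto
    have "mpoly c (S \<union> T) = [:c u, 1:] * mpoly c (S \<union> T - {u})
        - (\<Sum>y\<in>{y\<in>S \<union> T. E u y}. mpoly c (S \<union> T - {u, y}))"
      using less.prems u by (intro mpoly_rec) auto
    also have "\<dots> = [:c u, 1:] * (mpoly c (S - {u}) * mpoly c T)
        - (\<Sum>y\<in>{y\<in>S. E u y}. mpoly c (S - {u, y}) * mpoly c T)"
      unfolding N using u D IH by (intro arg_cong2[of _ _ _ _ "(-)"] sum.cong) auto
    also have "\<dots> = mpoly c S * mpoly c T"
      unfolding mpoly_rec[OF less.prems(1) u]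
      by (simp only: left_diff_distrib sum_distrib_right mult.assoc)
    finally show ?thesis .
  qed simp
qed

lemma pderiv_linear_mult: "pderiv ([:a, 1:] * p) = p + [:a, 1:] * pderiv p" for p :: "real poly"
  unfolding pderiv_mult by (simp add: pderiv_pCons)

lemma pderiv_mpoly:
  assumes "finite S"
  shows "pderiv (mpoly c S) = (\<Sum>v\<in>S. mpoly c (S - {v}))"
  using assms
proof (induction "card S" arbitrary: S rule: less_induct)
  case less
  show ?case
  proof (cases "S = {}")
    case False
    then obtain u where u: "u \<in> S" by blast
    define N where "N = {y\<in>S. E u y}"
    have uN: "u \<notin> N" "N \<subseteq> S" using irrefl by (auto simp: N_def)
    have IH: "pderiv (mpoly c (S - X)) = (\<Sum>v\<in>S - X. mpoly c (S - insert v X))" if "u \<in> X" for X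
    proof -
      have "card (S - X) < card S" using u that less.prems(1) by (intro psubset_card_mono) auto
      then have "pderiv (mpoly c (S - X)) = (\<Sum>v\<in>S - X. mpoly c (S - X - {v}))"
        using less by auto
      then show ?thesis by (simp add: Diff_insert[symmetric])
    qed
    \<comment> \<open>Regrouping by \<open>v\<close> turns the inner sums into the neighbour sums in
      the recursion at \<open>u\<close> for \<open>S - {v}\<close>.\<close>
    have "(\<Sum>y\<in>N. \<Sum>v\<in>S - {u, y}. mpoly c (S - {v, u, y}))
        = (\<Sum>y\<in>N. \<Sum>v\<in>{v \<in> S - {u}. v \<noteq> y}. mpoly c (S - {v, u, y}))"
      by (intro sum.cong) auto
    also have "\<dots> = (\<Sum>v\<in>S - {u}. \<Sum>y\<in>{y \<in> N. v \<noteq> y}. mpoly c (S - {v, u, y}))"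
      using less.prems uN by (intro sum.swap_restrict) (auto intro: finite_subset)
    also have "\<dots> = (\<Sum>v\<in>S - {u}. \<Sum>y\<in>{y \<in> S - {v}. E u y}. mpoly c (S - {v} - {u, y}))"
      by (intro sum.cong) (auto simp: N_def Diff_insert2[symmetric])
    finally have sw: "(\<Sum>y\<in>N. \<Sum>v\<in>S - {u, y}. mpoly c (S - {v, u, y}))
        = (\<Sum>v\<in>S - {u}. \<Sum>y\<in>{y \<in> S - {v}. E u y}. mpoly c (S - {v} - {u, y}))" .
    have "pderiv (mpoly c S) = mpoly c (S - {u}) + [:c u, 1:] * (\<Sum>v\<in>S - {u}. mpoly c (S - {v, u}))
        - (\<Sum>y\<in>N. \<Sum>v\<in>S - {u, y}. mpoly c (S - {v, u, y}))"
      unfolding mpoly_rec[OF less.prems u] N_def[symmetric]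
      by (simp add: pderiv_diff pderiv_linear_mult higher_pderiv_sum[where n = 1, simplified] IH
          del: mult_pCons_left)
    also have "\<dots> = mpoly c (S - {u}) + (\<Sum>v\<in>S - {u}. [:c u, 1:] * mpoly c (S - {v} - {u})
        - (\<Sum>y\<in>{y \<in> S - {v}. E u y}. mpoly c (S - {v} - {u, y})))"
      unfolding sw sum_subtractf sum_distrib_left by (simp add: Diff_insert2[symmetric] insert_commute)
    also have "\<dots> = mpoly c (S - {u}) + (\<Sum>v\<in>S - {u}. mpoly c (S - {v}))"
      using less.prems u by (intro arg_cong2[of _ _ _ _ "(+)"] sum.cong refl mpoly_rec[symmetric]) auto
    also have "\<dots> = (\<Sum>v\<in>S. mpoly c (S - {v}))"
      using less.prems u by (simp add: sum.remove[of S u])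
    finally show ?thesis .
  qed simp
qed

section \<open>The path-sum inequality\<close>

text \<open>Of the sum of squares over all paths from \<open>u\<close> to \<open>v\<close>, only the
  one-edge path is kept explicitly. Expanding at \<open>u\<close> both in \<open>S\<close> and in
  \<open>S - {v}\<close> leaves, for each neighbour \<open>y\<close> of \<open>u\<close> other than
  \<open>v\<close>, the corresponding difference for \<open>y\<close> and \<open>v\<close> in
  \<open>S - {u}\<close>, which is nonnegative by induction.\<close>

lemma mpoly_ineq:
  assumes "finite S" "u \<in> S" "v \<in> S" "u \<noteq> v"
  shows "poly (mpoly c S * mpoly c (S - {u, v})) x
      + (if E u v then (poly (mpoly c (S - {u, v})) x)\<^sup>2 else 0)
    \<le> poly (mpoly c (S - {u}) * mpoly c (S - {v})) x"
  using assms
proof (induction "card S" arbitrary: S u v rule: less_induct)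
  case less
  define m where "m X = poly (mpoly c X) x" for X
  define N where "N = {y\<in>S. E u y}"
  have rec: "m X = (c u + x) * m (X - {u}) - (\<Sum>y\<in>{y\<in>X. E u y}. m (X - {u, y}))"
    if "finite X" "u \<in> X" for X
    unfolding m_def mpoly_rec[OF that] by (simp add: poly_sum algebra_simps)
  have fin: "finite N" using less.prems by (simp add: N_def)
  have mv: "m (S - {v}) = (c u + x) * m (S - {u, v}) - (\<Sum>y\<in>N - {v}. m (S - {u, v, y}))"
  proof -
    have "{y \<in> S - {v}. E u y} = N - {v}" by (auto simp: N_def)
    moreover have "S - {v} - {u} = S - {u, v}" by auto
    moreover have "S - {v} - {u, y} = S - {u, v, y}" for y by auto
    ultimately show ?thesis using rec[of "S - {v}"] less.prems by simp
  qed
  have mS: "m S = (c u + x) * m (S - {u})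
      - ((\<Sum>y\<in>N - {v}. m (S - {u, y})) + (if E u v then m (S - {u, v}) else 0))"
  proof (cases "E u v")
    case True
    then have "v \<in> N" using less.prems by (simp add: N_def)
    then have "(\<Sum>y\<in>N. m (S - {u, y})) = (\<Sum>y\<in>N - {v}. m (S - {u, y})) + m (S - {u, v})"
      using sum.remove[OF fin, of v "\<lambda>y. m (S - {u, y})"] by simp
    then show ?thesis using rec[of S] less.prems True by (simp add: N_def)
  next
    case False
    then have "N - {v} = N" by (simp add: N_def)
    then show ?thesis using rec[of S] less.prems False by (simp add: N_def)
  qed
  have "m (S - {u}) * m (S - {v}) - m S * m (S - {u, v})
    = (\<Sum>y\<in>N - {v}. m (S - {u, y}) * m (S - {u, v}) - m (S - {u}) * m (S - {u, v, y}))
      + (if E u v then (m (S - {u, v}))\<^sup>2 else 0)"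
    unfolding mv mS sum_subtractf sum_distrib_left[symmetric] sum_distrib_right[symmetric]
    by (simp add: algebra_simps power2_eq_square)
  moreover have "0 \<le> (\<Sum>y\<in>N - {v}. m (S - {u, y}) * m (S - {u, v}) - m (S - {u}) * m (S - {u, v, y}))"
  proof (rule sum_nonneg)
    fix y assume y: "y \<in> N - {v}"
    then have y': "y \<in> S - {u}" "y \<noteq> v" using irrefl by (auto simp: N_def)
    have "card (S - {u}) < card S" using less.prems by (intro psubset_card_mono) auto
    \<comment> \<open>If \<open>y\<close> and \<open>v\<close> are adjacent, the induction
      hypothesis carries an extra square, which is dropped.\<close>
    from less.hyps[OF this, of y v] have "m (S - {u}) * m (S - {u} - {y, v})
        \<le> m (S - {u} - {y}) * m (S - {u} - {v})"
      using y' less.prems by (auto simp: m_def split: if_splits intro: order_trans[rotated])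
    moreover have "S - {u} - {y, v} = S - {u, v, y}" "S - {u} - {y} = S - {u, y}" "S - {u} - {v} = S - {u, v}"
      by auto
    ultimately show "0 \<le> m (S - {u, y}) * m (S - {u, v}) - m (S - {u}) * m (S - {u, v, y})" by simp
  qed
  ultimately show ?case unfolding m_def by simp
qed

lemma mpoly_ineq':
  assumes "finite S" "u \<in> S" "v \<in> S" "u \<noteq> v"
  shows "poly (mpoly c S * mpoly c (S - {u, v})) x \<le> poly (mpoly c (S - {u}) * mpoly c (S - {v})) x"
proof -
  have "0 \<le> (if E u v then (poly (mpoly c (S - {u, v})) x)\<^sup>2 else 0)" by simp
  then show ?thesis using mpoly_ineq[OF assms, of c x] by linarith
qed

abbreviation ord0 :: "('a \<Rightarrow> real) \<Rightarrow> 'a set \<Rightarrow> nat" where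
  "ord0 c S \<equiv> order 0 (mpoly c S)"

section \<open>Order at 0 under vertex deletion\<close>

text \<open>The derivative formula turns the Wronskian into a sum over \<open>v\<close> in
  \<open>S\<close>: the term \<open>v = u\<close> is the square, and all others are nonnegative by
  \<open>mpoly_ineq'\<close>.\<close>

lemma mpoly_wronskian:
  assumes "finite S" "u \<in> S"
  shows "(poly (mpoly c (S - {u})) x)\<^sup>2
    \<le> poly (pderiv (mpoly c S) * mpoly c (S - {u}) - mpoly c S * pderiv (mpoly c (S - {u}))) x"
proof -
  define m where "m X = poly (mpoly c X) x" for X
  have "poly (pderiv (mpoly c S) * mpoly c (S - {u}) - mpoly c S * pderiv (mpoly c (S - {u}))) x
    = (\<Sum>v\<in>S. m (S - {v})) * m (S - {u}) - m S * (\<Sum>v\<in>S - {u}. m (S - {u} - {v}))"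
    using assms by (simp add: pderiv_mpoly poly_sum m_def)
  also have "\<dots> = (m (S - {u}))\<^sup>2
      + (\<Sum>v\<in>S - {u}. m (S - {u}) * m (S - {v}) - m S * m (S - {u} - {v}))"
    unfolding sum.remove[OF assms] sum_subtractf sum_distrib_left[symmetric]
    by (simp add: algebra_simps power2_eq_square)
  also have "\<dots> \<ge> (m (S - {u}))\<^sup>2"
  proof -
    have "0 \<le> (\<Sum>v\<in>S - {u}. m (S - {u}) * m (S - {v}) - m S * m (S - {u} - {v}))"
    proof (rule sum_nonneg)
      fix v assume "v \<in> S - {u}"
      moreover have "S - {u} - {v} = S - {u, v}" by auto
      ultimately show "0 \<le> m (S - {u}) * m (S - {v}) - m S * m (S - {u} - {v})"
        using mpoly_ineq'[OF assms, of v c x] by (auto simp: m_def)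
    qed
    then show ?thesis by simp
  qed
  finally show ?thesis unfolding m_def .
qed

lemma ord0_le_Suc_delete:
  assumes "finite S" "u \<in> S"
  shows "ord0 c S \<le> Suc (ord0 c (S - {u}))"
  using wronskian_order(1)[OF mpoly_wronskian[OF assms]] assms by simp

text \<open>The common sign of the two lowest coefficients is what prevents cancellation among
  neighbour terms in the recursion.\<close>

lemma ord0_residue_pos:
  assumes "finite S" "u \<in> S" "ord0 c S = Suc (ord0 c (S - {u}))"
  shows "0 < coeff (mpoly c S) (ord0 c S) * coeff (mpoly c (S - {u})) (ord0 c (S - {u}))"
  using wronskian_order(2)[OF mpoly_wronskian[OF assms(1,2)]] assms by simp

lemma coeff_linear_mult_low:
  fixes p :: "real poly"
  assumes "i < order 0 p"
  shows "coeff ([:a, 1:] * p) i = 0"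
  using assms by (cases i) (auto simp: coeff_pCons coeff_less_order_0)

text \<open>Below degree \<open>b\<close>, the order for \<open>S - {u}\<close>, only the neighbour
  terms of the recursion contribute. Their coefficients of degree \<open>b - 1\<close>, multiplied
  by \<open>l\<close>, are nonnegative, and positive exactly for neighbours essential in
  \<open>S - {u}\<close>. So they cannot cancel, and their sum is nonzero iff such a neighbour
  exists.\<close>

lemma ord0_delete_eq_Suc_iff:
  assumes S: "finite S" and u: "u \<in> S"
  shows "ord0 c (S - {u}) = Suc (ord0 c S)
    \<longleftrightarrow> (\<exists>y\<in>S. E u y \<and> ord0 c (S - {u}) = Suc (ord0 c (S - {u, y})))"
    and ord0_delete_le_Suc: "ord0 c (S - {u}) \<le> Suc (ord0 c S)"
proof -
  define b where "b = ord0 c (S - {u})"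
  define N where "N = {y\<in>S. E u y}"
  define l where "l = coeff (mpoly c (S - {u})) b"
  have fin: "finite N" using S by (simp add: N_def)
  have ins: "S - {u} - {y} = S - {u, y}" for y by auto
  have yS: "y \<in> S - {u}" if "y \<in> N" for y using that irrefl by (auto simp: N_def)
  have Q: "b \<le> Suc (ord0 c (S - {u, y}))" if "y \<in> N" for y
    using ord0_le_Suc_delete[of "S - {u}" y c] yS[OF that] S ins by (auto simp: b_def)
  have pos: "0 < l * coeff (mpoly c (S - {u, y})) (b - 1)"
    if "y \<in> N" "b = Suc (ord0 c (S - {u, y}))" for y
    using ord0_residue_pos[of "S - {u}" y c] yS[OF that(1)] that(2) S ins by (auto simp: b_def l_def)
  have nonneg: "0 \<le> l * coeff (mpoly c (S - {u, y})) (b - 1)" if "y \<in> N" "0 < b" for y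
  proof (cases "b = Suc (ord0 c (S - {u, y}))")
    case False
    then have "coeff (mpoly c (S - {u, y})) (b - 1) = 0"
      using Q[OF that(1)] that(2) by (intro coeff_less_order_0) simp
    then show ?thesis by simp
  qed (use pos[OF that(1)] in simp)
  have coeff: "coeff (mpoly c S) i = - (\<Sum>y\<in>N. coeff (mpoly c (S - {u, y})) i)" if "i < b" for i
    unfolding mpoly_rec[OF S u] N_def coeff_diff coeff_sum
    using coeff_linear_mult_low[of i "mpoly c (S - {u})" "c u"] that by (simp add: b_def del: mult_pCons_left)
  \<comment> \<open>Every neighbour term has order at least \<open>b - 1\<close>; for
    \<open>b = 0\<close> the claim is empty.\<close>
  have "coeff (mpoly c S) i = 0" if "i < b - 1" for i
  proof -
    have "coeff (mpoly c (S - {u, y})) i = 0" if "y \<in> N" for y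
      using Q[OF that] \<open>i < b - 1\<close> by (intro coeff_less_order_0) simp
    then show ?thesis using coeff[of i] that by simp
  qed
  then have le: "b - 1 \<le> ord0 c S" using S by (simp add: le_order_0_iff)
  then show "ord0 c (S - {u}) \<le> Suc (ord0 c S)" by (simp add: b_def)
  show "ord0 c (S - {u}) = Suc (ord0 c S)
    \<longleftrightarrow> (\<exists>y\<in>S. E u y \<and> ord0 c (S - {u}) = Suc (ord0 c (S - {u, y})))" (is "?L \<longleftrightarrow> ?R")
  proof
    assume ?R
    then obtain y where y: "y \<in> N" "b = Suc (ord0 c (S - {u, y}))" by (auto simp: b_def N_def)
    then have "0 < (\<Sum>y\<in>N. l * coeff (mpoly c (S - {u, y})) (b - 1))"
      using pos nonneg fin by (intro sum_pos2[of N y]) auto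
    then have "coeff (mpoly c S) (b - 1) \<noteq> 0"
      using coeff[of "b - 1"] y(2) by (auto simp: sum_distrib_left[symmetric])
    then have "ord0 c S \<le> b - 1" using coeff_less_order_0[of "b - 1" "mpoly c S"] by (meson not_le)
    then show ?L using le y(2) by (simp add: b_def)
  next
    assume L: ?L
    show ?R
    proof (rule ccontr)
      assume "\<not> ?R"
      then have Q': "b \<le> ord0 c (S - {u, y})" if "y \<in> N" for y
        using Q[OF that] that by (auto simp: b_def N_def le_Suc_eq)
      have "coeff (mpoly c S) i = 0" if "i < b" for i
      proof -
        have "coeff (mpoly c (S - {u, y})) i = 0" if "y \<in> N" for y
          using Q'[OF that] \<open>i < b\<close> by (intro coeff_less_order_0) simp
        then show ?thesis using coeff[of i] that by simp
      qed
      then have "b \<le> ord0 c S" using S by (simp add: le_order_0_iff)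
      then show False using L by (simp add: b_def)
    qed
  qed
qed

text \<open>Differentiation lowers a positive order by exactly one. Since the derivative is the sum
  of the one-vertex deletions, one of these has order at most that of the derivative.\<close>

lemma ord0_pos_imp_delete:
  assumes S: "finite S" and pos: "0 < ord0 c S"
  shows "\<exists>u\<in>S. ord0 c S = Suc (ord0 c (S - {u}))"
proof -
  define a where "a = ord0 c S - 1"
  have a: "ord0 c S = Suc a" using pos by (simp add: a_def)
  have "coeff (pderiv (mpoly c S)) a \<noteq> 0"
    using coeff_order_0_nonzero[of "mpoly c S"] S a by (simp add: coeff_pderiv)
  then have "(\<Sum>v\<in>S. coeff (mpoly c (S - {v})) a) \<noteq> 0"
    using S by (simp add: pderiv_mpoly coeff_sum)
  then obtain v where v: "v \<in> S" "coeff (mpoly c (S - {v})) a \<noteq> 0" by (meson sum.neutral)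
  then have "ord0 c (S - {v}) \<le> a" using coeff_less_order_0 by (meson not_le)
  then show ?thesis using v(1) ord0_le_Suc_delete[OF S v(1), of c] a by (intro bexI[of _ v]) auto
qed

lemma ord0_pair_even:
  assumes "finite S" "u \<in> S" "v \<in> S" "u \<noteq> v"
  shows "ord0 c (S - {u}) + ord0 c (S - {v}) < ord0 c S + ord0 c (S - {u, v})
      \<Longrightarrow> even (ord0 c (S - {u}) + ord0 c (S - {v}))"
    "ord0 c S + ord0 c (S - {u, v}) < ord0 c (S - {u}) + ord0 c (S - {v})
      \<Longrightarrow> even (ord0 c S + ord0 c (S - {u, v}))"
  using nonneg_diff_even_order[OF mpoly_ineq'[OF assms]] assms(1) by simp_all

text \<open>The one-edge path makes the difference of products dominate the square of the polynomial
  of \<open>S - {u, v}\<close>, while the order of the difference is at least the minimum on the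
  left.\<close>

lemma ord0_edge:
  assumes "finite S" "u \<in> S" "v \<in> S" "u \<noteq> v" "E u v"
  shows "min (ord0 c (S - {u}) + ord0 c (S - {v})) (ord0 c S + ord0 c (S - {u, v}))
    \<le> 2 * ord0 c (S - {u, v})" (is "?n \<le> _")
proof (rule square_le_order)
  let ?p = "mpoly c (S - {u}) * mpoly c (S - {v}) - mpoly c S * mpoly c (S - {u, v})"
  show "(poly (mpoly c (S - {u, v})) x)\<^sup>2 \<le> poly ?p x" for x
    using mpoly_ineq[OF assms(1-4), of c x] assms(5) by simp
  show "\<forall>i<?n. coeff ?p i = 0"
  proof (intro allI impI)
    fix i assume i: "i < ?n"
    have "coeff (mpoly c (S - {u}) * mpoly c (S - {v})) i = 0" "coeff (mpoly c S * mpoly c (S - {u, v})) i = 0"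
      using i assms(1) by (auto intro!: coeff_less_order_0 simp: order_mult)
    then show "coeff ?p i = 0" by simp
  qed
qed (use assms in simp)

section \<open>Perturbing the weight of one vertex\<close>

text \<open>Only the linear factor in the recursion at \<open>u\<close> changes. The combination on
  the right is thus again a weighted matching polynomial, to which the inequalities apply.\<close>

lemma mpoly_shift:
  assumes "finite S" "u \<in> S"
  shows "mpoly (c(u := c u - d)) S = mpoly c S - smult d (mpoly c (S - {u}))"
proof -
  have eq: "mpoly (c(u := c u - d)) (S - X) = mpoly c (S - X)" if "u \<in> X" for X
    using that by (intro mpoly_cong) auto
  show ?thesis
    unfolding mpoly_rec[OF assms, of c] mpoly_rec[OF assms, of "c(u := c u - d)"]
    by (simp add: eq smult_diff_left)
qed

text \<open>Shifting the weight at \<open>u\<close> by a generic amount makes \<open>w\<close> and \<open>y\<close> neutral while deleting both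
  lowers the order by one, which contradicts parity.\<close>
lemma ord0_transitive:
  assumes S: "finite S" "u \<in> S" "w \<in> S" "y \<in> S" "w \<noteq> y" "u \<noteq> w" "u \<noteq> y"
    and u: "ord0 c S = Suc (ord0 c (S - {u}))"
    and uw: "ord0 c S \<le> Suc (ord0 c (S - {u, w}))"
    and uy: "ord0 c S \<le> Suc (ord0 c (S - {u, y}))"
  shows "ord0 c S \<noteq> Suc (Suc (ord0 c (S - {w, y})))"
proof
  define n where "n = ord0 c (S - {w, y})"
  assume "ord0 c S = Suc (Suc (ord0 c (S - {w, y})))"
  then have K: "ord0 c S = n + 2" by (simp add: n_def)
  define l where "l = coeff (mpoly c (S - {w, y})) n"
  define r where "r = coeff (mpoly c (S - {u, w, y})) n"
  define a where "a = coeff (mpoly c (S - {u})) (n + 1)"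
  have l0: "l \<noteq> 0" unfolding l_def n_def using S(1) by (intro coeff_order_0_nonzero) simp
  have a0: "a \<noteq> 0"
    using u K coeff_order_0_nonzero[of "mpoly c (S - {u})"] S(1) by (simp add: a_def)
  \<comment> \<open>A nonzero \<open>d\<close> lowers the order for \<open>S\<close> to
    \<open>n + 1\<close>; the second condition keeps the order for \<open>S - {w, y}\<close> equal
    to \<open>n\<close>.\<close>
  obtain d where d: "d \<noteq> 0" "l - d * r \<noteq> 0"
  proof (cases "l = r")
    case True
    then show ?thesis using that[of "-1"] l0 by simp
  next
    case False
    then show ?thesis using that[of 1] by simp
  qed
  define c' where "c' = c(u := c u - d)"
  have sh: "mpoly c' (S - X) = mpoly c (S - X) - smult d (mpoly c (S - insert u X))" if "u \<notin> X" for X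
  proof -
    have "S - X - {u} = S - insert u X" by auto
    then show ?thesis using mpoly_shift[of "S - X" u c d] that S by (simp add: c'_def)
  qed
  have w: "\<forall>i<n+1. coeff (mpoly c' (S - {w})) i = 0"
    using ord0_le_Suc_delete[OF S(1,3), of c] uw K S(6) by (auto simp: sh coeff_less_order_0)
  have y: "\<forall>i<n+1. coeff (mpoly c' (S - {y})) i = 0"
    using ord0_le_Suc_delete[OF S(1,4), of c] uy K S(7) by (auto simp: sh coeff_less_order_0)
  have e: "\<forall>i<n+1. coeff (mpoly c' S) i = 0" "coeff (mpoly c' S) (n + 1) = - d * a"
    using sh[of "{}"] u K by (auto simp: coeff_less_order_0 a_def)
  have "S - {u, w} - {y} = S - {u, w, y}" by auto
  then have "n \<le> ord0 c (S - {u, w, y})"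
    using ord0_le_Suc_delete[of "S - {u, w}" y c] S uw K by simp
  then have wy: "\<forall>i<n. coeff (mpoly c' (S - {w, y})) i = 0" "coeff (mpoly c' (S - {w, y})) n = l - d * r"
    using S(6,7) by (auto simp: sh coeff_less_order_0 n_def l_def r_def)
  let ?p = "mpoly c' (S - {w}) * mpoly c' (S - {y}) - mpoly c' S * mpoly c' (S - {w, y})"
  \<comment> \<open>The degree \<open>2 * n + 1\<close> is odd. The first product has order at least
    \<open>2 * n + 2\<close>, so only the second one contributes here, with a nonzero
    coefficient.\<close>
  have "coeff ?p (n + 1 + n) = 0"
  proof (rule nonneg_poly_low_coeff(2))
    show "0 \<le> poly ?p x" for x using mpoly_ineq'[OF S(1,3,4,5), of c' x] by simp
    show "\<forall>i<n + 1 + n. coeff ?p i = 0"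
      using coeff_mult_low(1)[OF w y] coeff_mult_low(1)[OF e(1) wy(1)] by simp
  qed simp
  moreover have "coeff (mpoly c' (S - {w}) * mpoly c' (S - {y})) (n + 1 + n) = 0"
    using coeff_mult_low(1)[OF w y] by simp
  moreover have "coeff (mpoly c' S * mpoly c' (S - {w, y})) (n + 1 + n) = - d * a * (l - d * r)"
    using coeff_mult_low(2)[OF e(1) wy(1)] e(2) wy(2) by simp
  ultimately show False using d a0 by simp
qed

section \<open>Comparison with the matching polynomial\<close>

lemma pcompose_monom: "pcompose (monom a m) q = smult a (q ^ m)" for q :: "real poly"
  by (induction m) (auto simp: monom_0 monom_Suc pcompose_pCons)

lemma card_Union_matching:
  assumes "finite S" "is_matching S E M"
  shows "card (\<Union>M) = 2 * card M"
proof -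
  have c2: "card e = 2" if "e \<in> M" for e
  proof -
    have "e \<in> graph_edges S E" using assms(2) that unfolding is_matching_def by blast
    then obtain x y where "e = {x, y}" "E x y" by (auto simp: graph_edges_def)
    then show ?thesis using irrefl by (cases "x = y") auto
  qed
  have "card (\<Union>M) = sum card M"
  proof (rule card_Union_disjoint)
    show "pairwise disjnt M" using assms(2) by (auto simp: is_matching_def pairwise_def disjnt_def)
    show "finite A" if "A \<in> M" for A using c2[OF that] by (simp add: card_ge_0_finite)
  qed
  then show ?thesis using c2 by simp
qed

text \<open>Group the matchings by their number \<open>r\<close> of edges: each leaves
  \<open>n - 2 * r\<close> uncovered vertices, all with the same linear factor.\<close>

lemma mpoly_const:
  assumes S: "finite S"
  shows "mpoly (\<lambda>_. t) S = pcompose (matching_poly S E) [:t, 1:]"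
proof -
  define P where "P = {M. is_matching S E M}"
  define n where "n = card S"
  have card: "card (\<Union>M) = 2 * card M" "2 * card M \<le> n" if "M \<in> P" for M
    using card_Union_matching[OF S] is_matching_Union that card_mono[OF S, of "\<Union>M"]
    by (auto simp: P_def n_def)
  have "mpoly (\<lambda>_. t) S = (\<Sum>M\<in>P. (-1) ^ card M * [:t, 1:] ^ (n - 2 * card M))"
    unfolding mpoly_def P_def[symmetric]
  proof (rule sum.cong)
    fix M assume M: "M \<in> P"
    then have "card (S - \<Union>M) = n - 2 * card M"
      using card(1)[OF M] is_matching_Union[of S M] finite_subset[OF _ S]
      by (simp add: card_Diff_subset P_def n_def)
    then show "(-1) ^ card M * (\<Prod>v\<in>S - \<Union>M. [:t, 1:]) = (-1) ^ card M * [:t, 1:] ^ (n - 2 * card M)"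
      by (simp add: prod_constant)
  qed simp
  also have "\<dots> = (\<Sum>r\<le>n div 2. \<Sum>M\<in>{M\<in>P. card M = r}. (-1) ^ card M * [:t, 1:] ^ (n - 2 * card M))"
    using finite_matchings[OF S] card(2)
    by (intro sum.group[symmetric]) (fastforce simp: P_def[symmetric])+
  also have "\<dots> = (\<Sum>r\<le>n div 2. smult ((-1) ^ r * real (num_matchings S E r)) ([:t, 1:] ^ (n - 2 * r)))"
  proof (rule sum.cong)
    fix r
    have "(\<Sum>M\<in>{M\<in>P. card M = r}. (-1) ^ card M * [:t, 1:] ^ (n - 2 * card M))
      = (\<Sum>M\<in>{M\<in>P. card M = r}. (-1) ^ r * [:t, 1:] ^ (n - 2 * r))"
      by (rule sum.cong) auto
    also have "\<dots> = of_nat (num_matchings S E r) * ((-1) ^ r * [:t, 1:] ^ (n - 2 * r))"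
      unfolding num_matchings_def P_def mem_Collect_eq by (rule sum_constant)
    also have "of_nat k * ((-1) ^ r * q) = smult ((-1) ^ r * real k) q" for k and q :: "real poly"
      by (cases "even r") (simp_all add: of_nat_poly)
    finally show "(\<Sum>M\<in>{M\<in>P. card M = r}. (-1) ^ card M * [:t, 1:] ^ (n - 2 * card M))
      = smult ((-1) ^ r * real (num_matchings S E r)) ([:t, 1:] ^ (n - 2 * r))" .
  qed simp
  finally show ?thesis
    unfolding matching_poly_def pcompose_sum pcompose_monom n_def .
qed

lemma mult_eq_ord0:
  assumes "finite S"
  shows "mult t S E = ord0 (\<lambda>_. t) S"
proof -
  have "matching_poly S E \<noteq> 0" using mpoly_const[OF assms, of t] mpoly_nonzero[OF assms] by auto
  then show ?thesis unfolding mult_def mpoly_const[OF assms] by (simp add: order_pcompose_shift)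
qed

section \<open>Stability of the Gallai--Edmonds decomposition\<close>

context
  fixes \<theta> :: real
begin

abbreviation k :: "'a set \<Rightarrow> nat" where
  "k S \<equiv> mult \<theta> S E"

section \<open>Interlacing and parity of multiplicities\<close>

lemma k_le_Suc_delete: "finite S \<Longrightarrow> u \<in> S \<Longrightarrow> k S \<le> Suc (k (S - {u}))"
  by (simp add: mult_eq_ord0 ord0_le_Suc_delete)

lemma k_delete_le_Suc: "finite S \<Longrightarrow> u \<in> S \<Longrightarrow> k (S - {u}) \<le> Suc (k S)"
  by (simp add: mult_eq_ord0 ord0_delete_le_Suc)

lemma k_delete2_le_Suc:
  assumes "finite S" "u \<in> S" "v \<in> S" "u \<noteq> v"
  shows "k (S - {u}) \<le> Suc (k (S - {u, v}))" "k (S - {u, v}) \<le> Suc (k (S - {u}))"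
  using k_le_Suc_delete[of "S - {u}" v] k_delete_le_Suc[of "S - {u}" v] assms
  by (simp_all add: Diff_insert2[symmetric])

lemma k_delete_eq_Suc_iff:
  assumes "finite S" "u \<in> S"
  shows "k (S - {u}) = Suc (k S) \<longleftrightarrow> (\<exists>y\<in>S. E u y \<and> k (S - {u}) = Suc (k (S - {u, y})))"
  using ord0_delete_eq_Suc_iff[OF assms, of "\<lambda>_. \<theta>"] assms by (simp add: mult_eq_ord0)

lemma k_pair_even:
  assumes "finite S" "u \<in> S" "v \<in> S" "u \<noteq> v"
  shows "k (S - {u}) + k (S - {v}) < k S + k (S - {u, v}) \<Longrightarrow> even (k (S - {u}) + k (S - {v}))"
    "k S + k (S - {u, v}) < k (S - {u}) + k (S - {v}) \<Longrightarrow> even (k S + k (S - {u, v}))"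
  using ord0_pair_even[OF assms, of "\<lambda>_. \<theta>"] assms(1) by (simp_all add: mult_eq_ord0)

lemma k_edge:
  assumes "finite S" "u \<in> S" "v \<in> S" "E u v"
  shows "min (k (S - {u}) + k (S - {v})) (k S + k (S - {u, v})) \<le> 2 * k (S - {u, v})"
proof -
  have "u \<noteq> v" using assms(4) irrefl by auto
  then show ?thesis
    using ord0_edge[OF assms(1-3) _ assms(4), of "\<lambda>_. \<theta>"] assms(1) by (simp add: mult_eq_ord0)
qed

lemma k_disjoint_union:
  assumes "finite S" "finite T" "S \<inter> T = {}" "\<And>x y. x \<in> S \<Longrightarrow> y \<in> T \<Longrightarrow> \<not> E x y"
  shows "k (S \<union> T) = k S + k T"
  using assms by (simp add: mult_eq_ord0 mpoly_disjoint_union order_mult)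

lemma essential_iff: "essential \<theta> S E u \<longleftrightarrow> u \<in> S \<and> k S = Suc (k (S - {u}))"
  by (auto simp: essential_def)

section \<open>Deleting one special vertex\<close>

text \<open>Suppose \<open>a\<close> were neutral. With an essential neighbour \<open>w\<close>,
  parity and interlacing force \<open>k (S - {a, w}) = k S - 1\<close>, so both products have order
  \<open>2 * k S - 1\<close>. The edge \<open>a w\<close> bounds this minimum by
  \<open>2 * k S - 2\<close>, a contradiction.\<close>

lemma special_positive:
  assumes S: "finite S" and a: "special \<theta> S E a"
  shows "k (S - {a}) = Suc (k S)"
proof (rule ccontr)
  obtain w where w: "w \<in> S" "k S = Suc (k (S - {w}))" "E a w"
    using a by (auto simp: special_def essential_iff)
  have aS: "a \<in> S" "k S \<noteq> Suc (k (S - {a}))" using a by (auto simp: special_def essential_iff)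
  have aw: "a \<noteq> w" using w(3) irrefl by auto
  assume "k (S - {a}) \<noteq> Suc (k S)"
  then have neutral: "k (S - {a}) = k S"
    using aS k_delete_le_Suc[OF S aS(1)] k_le_Suc_delete[OF S aS(1)] by simp
  then have "\<not> k (S - {a}) + k (S - {w}) < k S + k (S - {a, w})"
    using k_pair_even(1)[OF S aS(1) w(1) aw] w(2) by auto
  then have "k (S - {a, w}) = k (S - {w})"
    using neutral w(2) k_delete2_le_Suc(1)[OF S aS(1) w(1) aw] by simp
  then show False using k_edge[OF S aS(1) w(1,3)] neutral w(2) by simp
qed

lemma nonessential_delete_essential:
  assumes S: "finite S" and u: "u \<in> S" "\<not> essential \<theta> S E u" and w: "essential \<theta> S E w"
  shows "essential \<theta> (S - {u}) E w"
proof -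
  have wS: "w \<in> S" "k S = Suc (k (S - {w}))" "u \<noteq> w" "k S \<noteq> Suc (k (S - {u}))"
    using u w by (auto simp: essential_iff)
  have le: "k (S - {u}) \<le> Suc (k (S - {u, w}))" "k (S - {u, w}) \<le> Suc (k (S - {w}))"
    using k_delete2_le_Suc(1)[OF S u(1) wS(1,3)] k_delete2_le_Suc(2)[OF S wS(1) u(1) wS(3)[symmetric]]
    by (simp_all add: insert_commute)
  have "k (S - {u}) = Suc (k (S - {u, w}))"
  \<comment> \<open>For neutral \<open>u\<close> parity gives the missing upper bound on
    \<open>k (S - {u, w})\<close>; for positive \<open>u\<close> the interlacing bounds already
    determine it.\<close>
  proof (cases "k (S - {u}) = k S")
    case True
    then have "\<not> k (S - {u}) + k (S - {w}) < k S + k (S - {u, w})"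
      using k_pair_even(1)[OF S u(1) wS(1,3)] wS(2) by auto
    then show ?thesis using True le wS(2) by simp
  next
    case False
    then show ?thesis
      using k_delete_le_Suc[OF S u(1)] k_le_Suc_delete[OF S u(1)] wS le by simp
  qed
  then show ?thesis using wS by (auto simp: essential_iff Diff_insert2[symmetric])
qed

lemma special_delete_essential_iff:
  assumes S: "finite S" and a: "special \<theta> S E a" and "u \<noteq> a"
  shows "essential \<theta> (S - {a}) E u \<longleftrightarrow> essential \<theta> S E u"
proof
  have aS: "a \<in> S" using a by (simp add: special_def)
  have pos: "k (S - {a}) = Suc (k S)" by (rule special_positive[OF S a])
  have ess: "essential \<theta> (S - {a}) E v" if "essential \<theta> S E v" for v
    using nonessential_delete_essential[OF S aS _ that] a by (simp add: special_def)
  then show "essential \<theta> (S - {a}) E u" if "essential \<theta> S E u" using that .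
  obtain w where w: "essential \<theta> S E w" "E a w" using a by (auto simp: special_def)
  have wa: "w \<noteq> a" using w(2) irrefl by auto
  have w': "w \<in> S" "k S = Suc (k (S - {w}))" "k (S - {a}) = Suc (k (S - {a, w}))"
    using w(1) ess[OF w(1)] by (auto simp: essential_iff Diff_insert2[symmetric])
  assume u: "essential \<theta> (S - {a}) E u"
  then have u': "u \<in> S" "k (S - {a}) = Suc (k (S - {a, u}))"
    by (auto simp: essential_iff Diff_insert2[symmetric])
  show "essential \<theta> S E u"
  proof (rule ccontr)
    assume non: "\<not> essential \<theta> S E u"
    then have "k S \<noteq> Suc (k (S - {u}))" using u' by (simp add: essential_iff)
    then have "k S \<le> k (S - {u})" using k_le_Suc_delete[OF S u'(1)] by simp
    \<comment> \<open>Here \<open>k (S - {a, u}) = k S \<le> k (S - {u})\<close>, so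
      \<open>a\<close> is not positive in \<open>S - {u}\<close>, and no neighbour of
      \<open>a\<close> is essential in \<open>S - {u, a}\<close>.\<close>
    then have "k (S - {u} - {a}) \<noteq> Suc (k (S - {u}))"
      using u'(2) pos by (simp add: Diff_insert2[symmetric] insert_commute)
    then have nbr: "k (S - {u, a}) \<noteq> Suc (k (S - {u, a, y}))" if "y \<in> S" "E a y" "y \<noteq> u" for y
      using k_delete_eq_Suc_iff[of "S - {u}" a] that S aS \<open>u \<noteq> a\<close> by (auto simp: Diff_insert2[symmetric])
    have low: "k S \<le> k (S - {a, u, y})" if "y \<in> S" "E a y" "y \<noteq> u" for y
    proof -
      have "y \<noteq> a" using that irrefl by auto
      then have "k (S - {u, a}) \<le> Suc (k (S - {u, a, y}))"
        using k_le_Suc_delete[of "S - {u, a}" y] S that by (auto simp: Diff_insert[symmetric] insert_commute)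
      then show ?thesis using nbr[OF that] u'(2) pos by (simp add: insert_commute)
    qed
    have uw: "u \<noteq> w" using non w(1) by auto
    \<comment> \<open>By contrast, \<open>a\<close> is positive in \<open>S - {w}\<close>, which
      supplies a neighbour \<open>y\<close> essential in \<open>S - {w, a}\<close>.\<close>
    have "k (S - {w} - {a}) = Suc (k (S - {w}))"
      using w' pos by (simp add: Diff_insert2[symmetric] insert_commute)
    then obtain y where y: "y \<in> S" "y \<noteq> w" "E a y" "k (S - {w, a}) = Suc (k (S - {w, a, y}))"
      using k_delete_eq_Suc_iff[of "S - {w}" a] S aS wa by (auto simp: Diff_insert2[symmetric])
    have ya: "y \<noteq> a" using y(3) irrefl by auto
    have yk: "k S = Suc (k (S - {a, w, y}))" using y(4) w'(3) pos by (simp add: insert_commute)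
    \<comment> \<open>If \<open>y\<close> were \<open>u\<close>, the bound \<open>low\<close> for
      the neighbour \<open>w\<close> would contradict \<open>yk\<close>.\<close>
    have yu: "y \<noteq> u"
      using low[of w] yk w'(1) w(2) uw by (auto simp: insert_commute)
    \<comment> \<open>In \<open>S - {a}\<close> the vertex \<open>u\<close> is related to both
      \<open>w\<close> and \<open>y\<close>, whereas deleting \<open>w\<close> and \<open>y\<close>
      lowers the multiplicity from \<open>k S + 1\<close> to \<open>k S - 1\<close>.\<close>
    have "ord0 (\<lambda>_. \<theta>) (S - {a}) \<noteq> Suc (Suc (ord0 (\<lambda>_. \<theta>) (S - {a} - {w, y})))"
    proof (rule ord0_transitive)
      show "ord0 (\<lambda>_. \<theta>) (S - {a}) = Suc (ord0 (\<lambda>_. \<theta>) (S - {a} - {u}))"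
        using u by (simp add: essential_iff S flip: mult_eq_ord0)
      show "ord0 (\<lambda>_. \<theta>) (S - {a}) \<le> Suc (ord0 (\<lambda>_. \<theta>) (S - {a} - {u, w}))"
        using low[of w] w'(1) w(2) uw pos by (simp add: S Diff_insert2[symmetric] flip: mult_eq_ord0)
      show "ord0 (\<lambda>_. \<theta>) (S - {a}) \<le> Suc (ord0 (\<lambda>_. \<theta>) (S - {a} - {u, y}))"
        using low[of y] y yu pos by (simp add: S Diff_insert2[symmetric] flip: mult_eq_ord0)
    qed (use S w' wa y ya u' \<open>u \<noteq> a\<close> uw yu in auto)
    then show False
      using yk pos by (simp add: S Diff_insert2[symmetric] flip: mult_eq_ord0)
  qed
qed

lemma special_delete_B_set:
  assumes "finite S" "special \<theta> S E a"
  shows "B_set \<theta> (S - {a}) E = B_set \<theta> S E"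
proof -
  have "\<not> essential \<theta> S E a" using assms(2) by (simp add: special_def)
  then have "essential \<theta> (S - {a}) E u \<longleftrightarrow> essential \<theta> S E u" for u
    using special_delete_essential_iff[OF assms] by (cases "u = a") (auto simp: essential_def)
  then show ?thesis by (simp add: B_set_def)
qed

lemma special_delete_A_set:
  assumes "finite S" "special \<theta> S E a"
  shows "A_set \<theta> (S - {a}) E = A_set \<theta> S E - {a}"
proof -
  have "essential \<theta> (S - {a}) E = essential \<theta> S E"
    using special_delete_B_set[OF assms] by (auto simp: B_set_def)
  then show ?thesis by (auto simp: A_set_def special_def)
qed

text \<open>Essential vertices are already known to be preserved, so only neutral and positive could
  be interchanged. Since \<open>a\<close> is positive, either interchange would make the smaller of
  the two sums in \<open>k_pair_even\<close> equal to \<open>2 * k S + 1\<close>, which is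
  odd.\<close>

lemma special_delete_N_set:
  assumes S: "finite S" and a: "special \<theta> S E a"
  shows "N_set \<theta> (S - {a}) E = N_set \<theta> S E"
proof -
  have aS: "a \<in> S" using a by (simp add: special_def)
  have pos: "k (S - {a}) = Suc (k S)" by (rule special_positive[OF S a])
  have "k (S - {a, u}) = k (S - {a}) \<longleftrightarrow> k (S - {u}) = k S" if u: "u \<in> S" "u \<noteq> a" for u
  proof -
    have "k (S - {a}) = Suc (k (S - {a, u})) \<longleftrightarrow> k S = Suc (k (S - {u}))"
      using special_delete_essential_iff[OF S a u(2)] u by (simp add: essential_iff Diff_insert2[symmetric])
    note facts = this pos k_delete_le_Suc[OF S u(1)] k_le_Suc_delete[OF S u(1)]
      k_delete2_le_Suc[OF S aS u(1) u(2)[symmetric]] k_pair_even[OF S aS u(1) u(2)[symmetric]]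
    show ?thesis
    proof
      assume "k (S - {a, u}) = k (S - {a})"
      then show "k (S - {u}) = k S" using facts by (cases "k (S - {u}) = Suc (k S)") auto
    next
      assume "k (S - {u}) = k S"
      then show "k (S - {a, u}) = k (S - {a})"
        using facts by (cases "k (S - {a, u}) = Suc (k (S - {a}))") auto
    qed
  qed
  moreover have "k (S - {a}) \<noteq> k S" using pos by simp
  ultimately show ?thesis using aS by (auto simp: N_set_def neutral_def Diff_insert2[symmetric])
qed

text \<open>The essential neighbour of \<open>a\<close> survives by
  \<open>nonessential_delete_essential\<close>. As \<open>u\<close> is not essential in
  \<open>S - {a}\<close>, \<open>k (S - {a, u}) \<ge> k S + 1 \<ge> k (S - {u})\<close>, so
  \<open>a\<close> does not become essential.\<close>

lemma special_delete_nonessential: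
  assumes S: "finite S" and a: "special \<theta> S E a" and u: "u \<in> S" "\<not> essential \<theta> S E u" "u \<noteq> a"
  shows "special \<theta> (S - {u}) E a"
proof -
  have aS: "a \<in> S" using a by (simp add: special_def)
  have pos: "k (S - {a}) = Suc (k S)" by (rule special_positive[OF S a])
  have "k (S - {a}) \<noteq> Suc (k (S - {a, u}))"
    using special_delete_essential_iff[OF S a u(3)] u by (auto simp: essential_iff Diff_insert2[symmetric])
  then have "k (S - {u}) \<noteq> Suc (k (S - {u, a}))"
    using k_delete2_le_Suc[OF S aS u(1) u(3)[symmetric]] k_delete_le_Suc[OF S u(1)] pos
    by (simp add: insert_commute)
  then have "\<not> essential \<theta> (S - {u}) E a" by (simp add: essential_iff Diff_insert2[symmetric])
  moreover obtain w where "essential \<theta> S E w" "E a w" using a by (auto simp: special_def)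
  ultimately show ?thesis
    using nonessential_delete_essential[OF S u(1,2)] aS u(3) by (auto simp: special_def)
qed

text \<open>If \<open>v\<close> is essential in \<open>S - {u}\<close>, both inequalities hold.
  Otherwise \<open>a\<close> remains special, hence positive, after deleting \<open>u\<close> and
  \<open>v\<close>, so deleting \<open>a\<close> raises both sides of the inequality by one.\<close>

lemma special_delete_pair:
  assumes S: "finite S" and a: "special \<theta> S E a"
    and u: "u \<in> S" "\<not> essential \<theta> S E u" "u \<noteq> a"
    and v: "v \<in> S" "v \<noteq> a" and uv: "u \<noteq> v"
  shows "k (S - {a} - {u, v}) \<le> k (S - {a}) \<longleftrightarrow> k (S - {u, v}) \<le> k S"
proof -
  have aS: "a \<in> S" using a by (simp add: special_def)
  have pos: "k (S - {a}) = Suc (k S)" by (rule special_positive[OF S a])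
  have au: "special \<theta> (S - {u}) E a" by (rule special_delete_nonessential[OF S a u])
  have eq: "S - {u} - {v} - {a} = S - {a} - {u, v}" "S - {u} - {v} = S - {u, v}"
    "S - {u, v} - {a} = S - {a} - {u, v}" by auto
  show ?thesis
  proof (cases "essential \<theta> (S - {u}) E v")
    case True
    then have "k (S - {u, v}) \<le> k S"
      using k_delete_le_Suc[OF S u(1)] by (simp add: essential_iff eq)
    moreover have "k (S - {a} - {u, v}) \<le> Suc (k (S - {u, v}))"
      using k_delete_le_Suc[of "S - {u, v}" a] S aS u v by (simp add: eq)
    ultimately show ?thesis using pos by simp
  next
    case False
    then have "special \<theta> (S - {u} - {v}) E a"
      using S au v uv False by (auto intro: special_delete_nonessential[of "S - {u}"])
    then have "k (S - {u} - {v} - {a}) = Suc (k (S - {u} - {v}))"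
      using S special_positive[of "S - {u} - {v}" a] by simp
    then show ?thesis unfolding eq using pos by simp
  qed
qed

section \<open>Deleting all special vertices\<close>

text \<open>Special vertices are deleted one at a time. Each step removes only that vertex from
  \<open>A_set\<close> and keeps the other data, so the induction hypothesis ends in the same graph
  \<open>S - A_set \<theta> S E\<close>.\<close>

lemma delete_A_set:
  assumes "finite S"
  shows "B_set \<theta> (S - A_set \<theta> S E) E = B_set \<theta> S E
    \<and> N_set \<theta> (S - A_set \<theta> S E) E = N_set \<theta> S E
    \<and> A_set \<theta> (S - A_set \<theta> S E) E = {}
    \<and> (\<forall>u\<in>S - A_set \<theta> S E - B_set \<theta> S E. \<forall>v\<in>S - A_set \<theta> S E. u \<noteq> v \<longrightarrow>
        (k (S - A_set \<theta> S E - {u, v}) \<le> k (S - A_set \<theta> S E) \<longleftrightarrow> k (S - {u, v}) \<le> k S))"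
  using assms
proof (induction "card (A_set \<theta> S E)" arbitrary: S rule: less_induct)
  case less
  show ?case
  proof (cases "A_set \<theta> S E = {}")
    case False
    then obtain a where a: "special \<theta> S E a" by (auto simp: A_set_def)
    have aA: "a \<in> A_set \<theta> S E" using a by (simp add: A_set_def)
    have "finite (A_set \<theta> S E)"
      using less.prems by (rule finite_subset[rotated]) (auto simp: A_set_def special_def)
    then have lt: "card (A_set \<theta> (S - {a}) E) < card (A_set \<theta> S E)"
      unfolding special_delete_A_set[OF less.prems a] using aA by (rule card_Diff1_less)
    have eq: "S - {a} - (A_set \<theta> S E - {a}) = S - A_set \<theta> S E" using aA by auto
    note IH = less.hyps[OF lt, unfolded special_delete_A_set[OF less.prems a] special_delete_B_set[OF less.prems a]
        special_delete_N_set[OF less.prems a] eq]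
    show ?thesis
      using IH less.prems special_delete_pair[OF less.prems a] aA by (auto simp: B_set_def)
  qed simp
qed

end

section \<open>Components\<close>

lemma component_subset:
  assumes "Q \<in> components W E"
  shows "Q \<subseteq> W"
proof -
  obtain x where x: "x \<in> W" and Q: "Q = {y. (\<lambda>a b. a \<in> W \<and> b \<in> W \<and> E a b)\<^sup>*\<^sup>* x y}"
    using assms unfolding components_def by blast
  have "y \<in> W" if "(\<lambda>a b. a \<in> W \<and> b \<in> W \<and> E a b)\<^sup>*\<^sup>* x y" for y
    using that x by (induction rule: rtranclp_induct) auto
  then show ?thesis unfolding Q by blast
qed

lemma component_closed:
  assumes "Q \<in> components W E" "x \<in> Q" "y \<in> W - Q"
  shows "\<not> E x y"
proof
  assume "E x y"
  obtain z where Q: "Q = {y. (\<lambda>a b. a \<in> W \<and> b \<in> W \<and> E a b)\<^sup>*\<^sup>* z y}"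
    using assms(1) unfolding components_def by blast
  have "x \<in> W" using component_subset[OF assms(1)] assms(2) by blast
  then have "(\<lambda>a b. a \<in> W \<and> b \<in> W \<and> E a b)\<^sup>*\<^sup>* z y"
    using assms(2,3) \<open>E x y\<close> unfolding Q by (auto intro: rtranclp.rtrancl_into_rtrancl)
  then show False using assms(3) unfolding Q by simp
qed

lemma component_exists: "u \<in> W \<Longrightarrow> \<exists>Q\<in>components W E. u \<in> Q"
  unfolding components_def by blast

text \<open>A component is given by what is reachable from one root. Reachability is symmetric, so
  the induction can start at any of its vertices.\<close>

lemma component_induct:
  assumes Q: "Q \<in> components W E" and uv: "u \<in> Q" "v \<in> Q" and P: "P u"
    and step: "\<And>x y. x \<in> Q \<Longrightarrow> y \<in> W \<Longrightarrow> E x y \<Longrightarrow> P x \<Longrightarrow> P y"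
  shows "P v"
proof -
  let ?R = "\<lambda>a b. a \<in> W \<and> b \<in> W \<and> E a b"
  obtain z where z: "Q = {y. ?R\<^sup>*\<^sup>* z y}"
    using Q unfolding components_def by blast
  have "symp ?R" using sym by (auto intro: sympI)
  then have "?R\<^sup>*\<^sup>* u z" using uv(1) by (auto simp: z dest: symp_rtranclp sympD)
  then have "?R\<^sup>*\<^sup>* u v" using uv(2) by (auto simp: z)
  then have "v \<in> Q \<and> P v"
  proof (induction rule: rtranclp_induct)
    case (step x y)
    then show ?case using assms(5)[of x y] by (auto simp: z intro: rtranclp.rtrancl_into_rtrancl)
  qed (use uv P in simp)
  then show ?thesis by simp
qed

lemma component_unique:
  assumes "Q \<in> components W E" "Q' \<in> components W E" "u \<in> Q" "u \<in> Q'"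
  shows "Q = Q'"
proof -
  have "Q1 \<subseteq> Q2" if "Q1 \<in> components W E" "Q2 \<in> components W E" "u \<in> Q1" "u \<in> Q2" for Q1 Q2
  proof
    fix v assume "v \<in> Q1"
    show "v \<in> Q2"
      using that(1,3) \<open>v \<in> Q1\<close> that(4)
    proof (rule component_induct)
      show "y \<in> Q2" if "y \<in> W" "E x y" "x \<in> Q2" for x y
        using component_closed[OF \<open>Q2 \<in> components W E\<close>] that by blast
    qed
  qed
  then show ?thesis using assms by blast
qed

section \<open>Multiplicities over components\<close>

lemma mult_component:
  assumes "finite W" "Q \<in> components W E"
  shows "mult \<theta> (W - X) E = mult \<theta> (Q - X) E + mult \<theta> (W - Q - X) E"
proof -
  have "W - X = (Q - X) \<union> (W - Q - X)" using component_subset[OF assms(2)] by auto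
  then show ?thesis
    using k_disjoint_union[of "Q - X" "W - Q - X" \<theta>] component_closed[OF assms(2)]
      finite_subset[OF component_subset[OF assms(2)] assms(1)] assms(1) by auto
qed

lemma essential_component_iff:
  assumes "finite W" "Q \<in> components W E" "u \<in> Q"
  shows "essential \<theta> W E u \<longleftrightarrow> essential \<theta> Q E u"
proof -
  have "W - Q - {u} = W - Q" using assms(3) by auto
  then show ?thesis
    using mult_component[OF assms(1,2), of \<theta> "{u}"] mult_component[OF assms(1,2), of \<theta> "{}"]
      component_subset[OF assms(2)] assms(3) by (auto simp: essential_iff)
qed

text \<open>A component of positive multiplicity contains an essential vertex. Without special
  vertices, essentiality passes to every neighbour and so fills the component.\<close>

lemma nonessential_iff_component:
  assumes W: "finite W" and A: "A_set \<theta> W E = {}" and Q: "Q \<in> components W E" and u: "u \<in> Q"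
  shows "\<not> essential \<theta> W E u \<longleftrightarrow> mult \<theta> Q E = 0"
proof
  have fin: "finite Q" using component_subset[OF Q] W by (rule finite_subset)
  assume non: "\<not> essential \<theta> W E u"
  show "mult \<theta> Q E = 0"
  proof (rule ccontr)
    assume "mult \<theta> Q E \<noteq> 0"
    then have "0 < ord0 (\<lambda>_. \<theta>) Q" using fin by (simp add: mult_eq_ord0)
    then obtain z where z: "z \<in> Q" "essential \<theta> Q E z"
      using ord0_pos_imp_delete[OF fin] fin by (auto simp: essential_iff mult_eq_ord0)
    have "essential \<theta> W E u"
      using Q z(1) u
    proof (rule component_induct)
      show "essential \<theta> W E z" using essential_component_iff[OF W Q z(1)] z(2) by simp
      show "essential \<theta> W E y" if "y \<in> W" "E x y" "essential \<theta> W E x" for x y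
        using A that sym by (auto simp: A_set_def special_def)
    qed
    then show False using non by simp
  qed
next
  assume "mult \<theta> Q E = 0"
  then show "\<not> essential \<theta> W E u"
    using essential_component_iff[OF W Q u] by (simp add: essential_iff)
qed

text \<open>Both components have multiplicity zero, so the inequality says that deletion creates no
  multiplicity inside them. For distinct components the contributions of \<open>Q1 - {u}\<close> and
  \<open>Q2 - {v}\<close> add, and each vanishes iff its vertex is neutral.\<close>

lemma pair_no_special:
  assumes W: "finite W" and A: "A_set \<theta> W E = {}"
    and Q1: "Q1 \<in> components W E" "u \<in> Q1" "\<not> essential \<theta> W E u"
    and Q2: "Q2 \<in> components W E" "v \<in> Q2" "\<not> essential \<theta> W E v"
  shows "mult \<theta> (W - {u, v}) E \<le> mult \<theta> W E \<longleftrightarrow>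
    (if Q1 = Q2 then mult \<theta> (Q1 - {u, v}) E = 0 else neutral \<theta> W E u \<and> neutral \<theta> W E v)"
proof (cases "Q1 = Q2")
  case True
  have "W - Q1 - {u, v} = W - Q1" using Q1(2) Q2(2) True by auto
  then show ?thesis
    using mult_component[OF W Q1(1), of \<theta> "{u, v}"] mult_component[OF W Q1(1), of \<theta> "{}"]
      nonessential_iff_component[OF W A Q1(1,2)] Q1(3) True by simp
next
  case False
  have v: "v \<notin> Q1" "v \<in> W" and u: "u \<notin> Q2" "u \<in> W"
    using component_unique[OF Q1(1) Q2(1)] component_subset[OF Q1(1)] component_subset[OF Q2(1)]
      Q1(2) Q2(2) False by auto
  have zero: "mult \<theta> Q1 E = 0" "mult \<theta> Q2 E = 0"
    using nonessential_iff_component[OF W A Q1(1,2)] nonessential_iff_component[OF W A Q2(1,2)] Q1(3) Q2(3)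
    by simp_all
  have set: "Q1 - {u, v} = Q1 - {u}" "W - Q1 - {u, v} = W - Q1 - {v}" "W - Q1 - {u} = W - Q1"
    "W - Q2 - {v} = W - Q2" "Q1 - {v} = Q1"
    using v u Q1(2) Q2(2) by auto
  show ?thesis
    using mult_component[OF W Q1(1), of \<theta> "{u, v}"] mult_component[OF W Q1(1), of \<theta> "{v}"]
      mult_component[OF W Q1(1), of \<theta> "{u}"] mult_component[OF W Q1(1), of \<theta> "{}"]
      mult_component[OF W Q2(1), of \<theta> "{v}"] mult_component[OF W Q2(1), of \<theta> "{}"]
      zero u v False by (auto simp: set neutral_def)
qed

end

section \<open>Edges of \<open>D\<^sub>\<theta>\<close>\<close>

theorem theorem5p18:
  fixes V :: "'a set" and E :: "'a \<Rightarrow> 'a \<Rightarrow> bool" and \<theta> :: real and u v :: 'a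
  assumes "simple_graph V E"
    and "u \<in> V" and "v \<in> V" and "u \<noteq> v"
  defines "Qs \<equiv> {Q \<in> components (V - A_set \<theta> V E) E. mult \<theta> Q E = 0}"
  shows "mult \<theta> (V - {u, v}) E \<le> mult \<theta> V E \<longleftrightarrow>
           (u \<in> B_set \<theta> V E \<or> v \<in> B_set \<theta> V E)
         \<or> (u \<in> N_set \<theta> V E \<and> v \<in> N_set \<theta> V E \<and>
              (\<exists>Q1\<in>Qs. \<exists>Q2\<in>Qs. Q1 \<noteq> Q2 \<and> u \<in> Q1 \<and> v \<in> Q2))
         \<or> (\<exists>Q\<in>Qs. u \<in> Q \<and> v \<in> Q \<and> mult \<theta> (Q - {u, v}) E = 0)"
    (is "?edge \<longleftrightarrow> ?B \<or> ?N \<or> ?Q")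
proof -
  have V: "finite V" using assms(1) by (simp add: simple_graph_def)
  interpret matching_graph E
    using assms(1) by unfold_locales (auto simp: simple_graph_def)
  define W where "W = V - A_set \<theta> V E"
  have W: "finite W" using V by (simp add: W_def)
  note W_props = delete_A_set[OF V, of \<theta>, folded W_def]
  have Qs: "Q \<in> components W E" "mult \<theta> Q E = 0" if "Q \<in> Qs" for Q
    using that by (simp_all add: Qs_def W_def)
  \<comment> \<open>Deleting an essential vertex lowers the multiplicity by one, and a second
    deletion raises it by at most one. Stating this for \<open>{x, y} = {u, v}\<close> covers both
    orders of the pair.\<close>
  have edge_B: "?edge" if "essential \<theta> V E x" "{x, y} = {u, v}" for x y
  proof -
    have xy: "x \<in> V" "y \<in> V" "x \<noteq> y" using that assms by (auto simp: doubleton_eq_iff)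
    then show ?thesis
      using k_delete2_le_Suc(2)[OF V xy, of \<theta>] that by (simp add: essential_iff)
  qed
  \<comment> \<open>A special \<open>x\<close> raises the multiplicity by one, and \<open>y\<close>
    stays nonessential in \<open>V - {x}\<close>, so deleting \<open>y\<close> cannot undo
    this.\<close>
  have not_edge_A: "\<not> ?edge" if "special \<theta> V E x" "\<not> essential \<theta> V E y" "{x, y} = {u, v}" for x y
  proof -
    have xy: "x \<in> V" "y \<in> V" "x \<noteq> y" using that assms by (auto simp: doubleton_eq_iff)
    have "\<not> essential \<theta> (V - {x}) E y"
      using special_delete_essential_iff[OF V that(1), of y] that(2) xy by simp
    then show ?thesis
      using k_delete2_le_Suc(1)[OF V xy, of \<theta>] special_positive[OF V that(1)] xy that(3)
      by (auto simp: essential_iff Diff_insert2[symmetric])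
  qed
  show ?thesis
  proof (cases "?B")
    case True
    then have ?edge using edge_B[of u v] edge_B[of v u] by (auto simp: B_set_def)
    then show ?thesis using True by blast
  next
    case noB: False
    then have non: "\<not> essential \<theta> V E u" "\<not> essential \<theta> V E v" by (simp_all add: B_set_def)
    show ?thesis
    proof (cases "u \<in> W \<and> v \<in> W")
      case False
      then have "special \<theta> V E u \<or> special \<theta> V E v" using assms(2,3) by (auto simp: W_def A_set_def)
      then have "\<not> ?edge" using not_edge_A[of u v] not_edge_A[of v u] non by auto
      moreover have "\<not> ?N" "\<not> ?Q" using False Qs component_subset by blast+
      ultimately show ?thesis using noB by blast
    next
      case True
      then obtain Q1 Q2 where Q: "Q1 \<in> components W E" "u \<in> Q1" "Q2 \<in> components W E" "v \<in> Q2"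
        using component_exists by meson
      have nonW: "\<not> essential \<theta> W E u" "\<not> essential \<theta> W E v"
        using W_props noB by (auto simp: B_set_def)
      have A: "A_set \<theta> W E = {}" using W_props by blast
      \<comment> \<open>Nonessential vertices lie in components of multiplicity zero, and each
        vertex determines its component; the existential statements therefore speak about
        \<open>Q1\<close> and \<open>Q2\<close>.\<close>
      have "Q1 \<in> Qs" "Q2 \<in> Qs"
        using nonessential_iff_component[OF W A] Q nonW by (auto simp: Qs_def W_def)
      moreover have "Q' = Q1" if "Q' \<in> Qs" "u \<in> Q'" for Q'
        using component_unique[OF Qs(1)[OF that(1)] Q(1) that(2) Q(2)] .
      moreover have "Q' = Q2" if "Q' \<in> Qs" "v \<in> Q'" for Q'
        using component_unique[OF Qs(1)[OF that(1)] Q(3) that(2) Q(4)] .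
      ultimately have N: "?N \<longleftrightarrow> u \<in> N_set \<theta> V E \<and> v \<in> N_set \<theta> V E \<and> Q1 \<noteq> Q2"
        and QQ: "?Q \<longleftrightarrow> Q1 = Q2 \<and> mult \<theta> (Q1 - {u, v}) E = 0"
        using Q by blast+
      \<comment> \<open>Neither vertex is special or essential, so deleting all special vertices
        does not affect whether the pair is an edge.\<close>
      have "?edge \<longleftrightarrow> mult \<theta> (W - {u, v}) E \<le> mult \<theta> W E"
        using W_props True noB assms(4) by (auto simp: W_def)
      also have "\<dots> \<longleftrightarrow> (if Q1 = Q2 then mult \<theta> (Q1 - {u, v}) E = 0
          else neutral \<theta> W E u \<and> neutral \<theta> W E v)"
        by (rule pair_no_special[OF W A Q(1,2) nonW(1) Q(3,4) nonW(2)])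
      also have "neutral \<theta> W E = neutral \<theta> V E"
        using W_props by (auto simp: N_set_def)
      finally show ?thesis unfolding N QQ using noB by (auto simp: N_set_def)
    qed
  qed
qed

end
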